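(* Let $q\in(0,1)$, $s\in(-1,0)$, $u_y,v_x\in[0,1)$ for $x,y\in\mathbb{Z}_{\ge1}$. Let $\boldsymbol\lambda=\{\lambda^{(x,y)}\}_{x,y\ge0}$ be the sHL/sHL Yang-Baxter field with the step boundary conditions and parameters $u_y,v_x$, and let $\mathfrak{h}^{\mathrm{6V}}(x,y)$ be the height function of the stochastic six vertex model with parameters $u_y,v_x$ and the step boundary conditions. Then the two random fields $\{y-\ell(\lambda^{(x,y)}):x,y\in\mathbb{Z}_{\ge0}\}$ and $\{\mathfrak{h}^{\mathrm{6V}}(x+1,y):x,y\in\mathbb{Z}_{\ge0}\}$ are equal in distribution.
   Context: **Young diagrams.** $\lambda=1^{l_1}2^{l_2}\cdots$ has $l_i$ parts equal to $i$; $\ell(\lambda)=\sum_i l_i$. **Weights.** $(a;q)_k=\prod_{i=1}^k(1-aq^{i-1})$. For $g\in\mathbb{Z}_{\ge0}$: $w_u(g,0;g,0)=\frac{1-suq^g}{1-su}$, $w_u(g+1,0;g,1)=\frac{u(1-s^2q^g)}{1-su}$, $w_u(g,1;g,1)=\frac{u-sq^g}{1-su}$, $w_u(g,1;g+1,0)=\frac{1-q^{g+1}}{1-su}$, all others $0$. $w^*_v(i_1,j_1;i_2,j_2)=\frac{(s^2;q)_{i_1}(q;q)_{i_2}}{(q;q)_{i_1}(s^2;q)_{i_2}}w_v(i_2,j_1;i_1,j_2)$. Cross weights, $z=uv$: $R_z(0,0;0,0)=1$, $R_z(1,0;1,0)=R_z(0,1;0,1)=\frac{1-qz}{1-z}$,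 $R_z(1,1;1,1)=q$, $R_z(1,1;0,0)=\frac{1-q}{1-z}$, $R_z(0,0;1,1)=\frac{z(1-q)}{1-z}$, all others $0$. They satisfy the Yang-Baxter equation: for every boundary data $c=(a,a',m;b,b',l)$, $a,a',b,b'\in\{0,1\}$, $m,l\in\mathbb{Z}_{\ge0}$, $$\sum_{k,p,p'}R_{uv}(a,a';p',p)w^*_v(m,p;k,b)w_u(k,p';l,b')=\sum_{n,t,t'}w^*_v(n,a';l,t')w_u(m,a;n,t)R_{uv}(t,t';b',b).\quad(\mathrm{YB}_c)$$ **Bijectivization.** For each $c$ for which the sums are positive, fix a coupling of the two probability measures, on triples $(k,p,p')$ and on triples $(n,t,t')$, that are proportional to the (nonnegative) summands on the left and on the right of $(\mathrm{YB}_c)$; let $\mathbf{p}_c((k,p,p')\to(n,t,t'))$ be the conditional probability of $(n,t,t')$ given $(k,p,p')$ under the coupling. **Forward transition $\varkappa\to\nu$ given $\lambda,\mu$ with parameters $u,v$.** Let $\varkappa=1^{k_1}2^{k_2}\cdots$, $\mu=1^{m_1}2^{m_2}\cdots$, $\lambda=1^{l_1}2^{l_2}\cdots$ and $i_h=\sum_{r>h}(m_r-k_r)$, $i'_h=\sum_{r>h}(l_r-k_r)$ for $h\ge0$ (all in $\{0,1\}$). First choose $(j_0,j_0')\in\{0,1\}^2$ with probability $$\frac{v^{j_0'}u^{j_0}R_{uv}(j_0,j_0';i_0',i_0)}{\frac{1-quv}{1-uv}\,v^{i_0}u^{i_0'}}$$ (after cancelling common powers of $u,v$). Then for $h=1,2,\dots$,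 given $(j_{h-1},j'_{h-1})$, choose $(n_h,j_h,j'_h)$ with probability $\mathbf{p}_c((k_h,i_{h-1},i'_{h-1})\to(n_h,j_h,j_h'))$, $c=(j_{h-1},j'_{h-1},m_h;i_h,i'_h,l_h)$. The output is $\nu=1^{n_1}2^{n_2}\cdots$. The couplings are chosen so that almost surely $j_h=j'_h=0$ for large $h$ (so $\nu$ is a Young diagram); such couplings exist. Then $\ell(\nu)=\ell(\mu)+j_0=\ell(\lambda)+j_0'$. **The field.** $\lambda^{(x,0)}=\lambda^{(0,y)}=\varnothing$ for all $x,y\ge0$, and inductively in $x+y$, with independent randomness, $\lambda^{(x,y)}$ ($x,y\ge1$) is the output $\nu$ of the forward transition with $\varkappa=\lambda^{(x-1,y-1)}$, $\mu=\lambda^{(x,y-1)}$, $\lambda=\lambda^{(x-1,y)}$ and parameters $u=u_y$, $v=v_x$. "The sHL/sHL Yang-Baxter field" means any field obtained in this way, for any choice (for each $c$ with positive sums) of couplings of the two probability measures proportional to the summands on the two sides of $(\mathrm{YB}_c)$ such that almost surely $j_h=j'_h=0$ for large $h$. **Stochastic six vertex model.** A random configuration of up-right directed paths on $\mathbb{Z}_{\ge0}^2$, at most one path per edge. Vertex $(x,y)$, $x,y\ge1$, has configuration $(i_1,j_1;i_2,j_2)$ ($i_1$: enters from below, $j_1$: enters from the left, $i_2$: exits up, $j_2$: exits right). Sequentially in $x+y$ and independently given the inputs, $(i_2,j_2)$ is chosen given $(i_1,j_1)$ with probability $\mathsf{L}_{u_yv_x}(i_1,j_1;i_2,j_2)$,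 where $\mathsf{L}_z(0,0;0,0)=\mathsf{L}_z(1,1;1,1)=1$, $\mathsf{L}_z(1,0;1,0)=\frac{q(1-z)}{1-qz}$, $\mathsf{L}_z(1,0;0,1)=\frac{1-q}{1-qz}$, $\mathsf{L}_z(0,1;0,1)=\frac{1-z}{1-qz}$, $\mathsf{L}_z(0,1;1,0)=\frac{z(1-q)}{1-qz}$. Step boundary conditions: a path enters horizontally into $(1,y)$ for each $y\ge1$, none from below. $\mathfrak{h}^{\mathrm{6V}}(x,y)$ is the number of paths passing weakly to the right of the vertex $(x,y)$; i.e. $\mathfrak{h}^{\mathrm{6V}}(x+1,y)$ is the number of $k\in\{1,\dots,y\}$ such that the horizontal edge $(x,k)\to(x+1,k)$ is occupied. *)

theory Defs
  imports "HOL-Probability.Probability" "HOL-Library.Multiset"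
begin

section \<open>Vertex weights\<close>

definition qpoch :: "real \<Rightarrow> real \<Rightarrow> nat \<Rightarrow> real" where
  "qpoch a q k = (\<Prod>i=1..k. 1 - a * q ^ (i - 1))"

text \<open>In all weights the arguments are in the order \<open>(i\<^sub>1, j\<^sub>1; i\<^sub>2, j\<^sub>2)\<close>.\<close>

definition w :: "real \<Rightarrow> real \<Rightarrow> real \<Rightarrow> nat \<Rightarrow> nat \<Rightarrow> nat \<Rightarrow> nat \<Rightarrow> real" where
  "w q s u i1 j1 i2 j2 =
    (if j1 = 0 \<and> j2 = 0 \<and> i2 = i1 then (1 - s * u * q ^ i1) / (1 - s * u)
     else if j1 = 0 \<and> j2 = 1 \<and> i1 = i2 + 1 then u * (1 - s\<^sup>2 * q ^ i2) / (1 - s * u)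
     else if j1 = 1 \<and> j2 = 1 \<and> i2 = i1 then (u - s * q ^ i1) / (1 - s * u)
     else if j1 = 1 \<and> j2 = 0 \<and> i2 = i1 + 1 then (1 - q ^ (i1 + 1)) / (1 - s * u)
     else 0)"

definition wstar :: "real \<Rightarrow> real \<Rightarrow> real \<Rightarrow> nat \<Rightarrow> nat \<Rightarrow> nat \<Rightarrow> nat \<Rightarrow> real" where
  "wstar q s v i1 j1 i2 j2 =
    (qpoch (s\<^sup>2) q i1 * qpoch q q i2) / (qpoch q q i1 * qpoch (s\<^sup>2) q i2) * w q s v i2 j1 i1 j2"

definition R :: "real \<Rightarrow> real \<Rightarrow> nat \<Rightarrow> nat \<Rightarrow> nat \<Rightarrow> nat \<Rightarrow> real" where
  "R q z i1 j1 i2 j2 =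
    (if (i1, j1, i2, j2) = (0, 0, 0, 0) then 1
     else if (i1, j1, i2, j2) = (1, 0, 1, 0) \<or> (i1, j1, i2, j2) = (0, 1, 0, 1)
       then (1 - q * z) / (1 - z)
     else if (i1, j1, i2, j2) = (1, 1, 1, 1) then q
     else if (i1, j1, i2, j2) = (1, 1, 0, 0) then (1 - q) / (1 - z)
     else if (i1, j1, i2, j2) = (0, 0, 1, 1) then z * (1 - q) / (1 - z)
     else 0)"

section \<open>Bijectivization of the Yang--Baxter equation\<close>

text \<open>Boundary data are \<open>(a, a', m, b, b', l)\<close>; a state is \<open>(k, p, p')\<close> on the left-hand side
  of the Yang--Baxter equation and \<open>(n, t, t')\<close> on the right-hand side.\<close>

type_synonym boundary = "nat \<times> nat \<times> nat \<times> nat \<times> nat \<times> nat"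
type_synonym state = "nat \<times> nat \<times> nat"

definition YB_left :: "real \<Rightarrow> real \<Rightarrow> real \<Rightarrow> real \<Rightarrow> boundary \<Rightarrow> state \<Rightarrow> real" where
  "YB_left q s u v = (\<lambda>(a, a', m, b, b', l) (k, p, p').
     R q (u * v) a a' p' p * wstar q s v m p k b * w q s u k p' l b')"

definition YB_right :: "real \<Rightarrow> real \<Rightarrow> real \<Rightarrow> real \<Rightarrow> boundary \<Rightarrow> state \<Rightarrow> real" where
  "YB_right q s u v = (\<lambda>(a, a', m, b, b', l) (n, t, t').
     wstar q s v n a' l t' * w q s u m a n t * R q (u * v) t t' b' b)"

text \<open>The summands vanish unless \<open>p, p', t, t' \<in> {0, 1}\<close>, and only finitely many are nonzero.\<close>

definition YB_left_sum :: "real \<Rightarrow> real \<Rightarrow> real \<Rightarrow> real \<Rightarrow> boundary \<Rightarrow> real" where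
  "YB_left_sum q s u v c = (\<Sum>\<^sub>\<infinity>x. YB_left q s u v c x)"

definition YB_right_sum :: "real \<Rightarrow> real \<Rightarrow> real \<Rightarrow> real \<Rightarrow> boundary \<Rightarrow> real" where
  "YB_right_sum q s u v c = (\<Sum>\<^sub>\<infinity>x. YB_right q s u v c x)"

definition is_coupling ::
    "real \<Rightarrow> real \<Rightarrow> real \<Rightarrow> real \<Rightarrow> boundary \<Rightarrow> (state \<times> state) pmf \<Rightarrow> bool" where
  "is_coupling q s u v c Q \<longleftrightarrow>
     (\<forall>x. pmf (map_pmf fst Q) x = YB_left q s u v c x / YB_left_sum q s u v c) \<and>
     (\<forall>y. pmf (map_pmf snd Q) y = YB_right q s u v c y / YB_right_sum q s u v c)"

text \<open>A family of couplings, one for each pair of parameters and each boundary datum; its values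
  where the sums are not positive are unconstrained.\<close>

type_synonym couplings = "real \<Rightarrow> real \<Rightarrow> boundary \<Rightarrow> (state \<times> state) pmf"

definition bijectivization :: "real \<Rightarrow> real \<Rightarrow> real \<Rightarrow> real \<Rightarrow> couplings \<Rightarrow> bool" where
  "bijectivization q s u v Q \<longleftrightarrow>
     (\<forall>a\<in>{0, 1}. \<forall>a'\<in>{0, 1}. \<forall>b\<in>{0, 1}. \<forall>b'\<in>{0, 1}. \<forall>m l.
        let c = (a, a', m, b, b', l) in
          0 < YB_left_sum q s u v c \<and> 0 < YB_right_sum q s u v c \<longrightarrow>
            is_coupling q s u v c (Q u v c))"

definition bij_prob :: "(state \<times> state) pmf \<Rightarrow> state \<Rightarrow> state \<Rightarrow> real" where
  "bij_prob Q x y = pmf Q (x, y) / pmf (map_pmf fst Q) x"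

section \<open>The forward transition\<close>

text \<open>A Young diagram is the multiset of its (positive) parts: \<open>\<lambda> = 1\<^bsup>l\<^sub>1\<^esup> 2\<^bsup>l\<^sub>2\<^esup> \<dots>\<close> has
  \<open>l\<^sub>h = count \<lambda> h\<close> and \<open>\<ell>(\<lambda>) = size \<lambda>\<close>.\<close>

type_synonym diagram = "nat multiset"

text \<open>\<open>excess \<kappa> \<mu> h\<close> is \<open>\<Sum>\<^bsub>r>h\<^esub> (m\<^sub>r - k\<^sub>r)\<close>, restricted to the finitely many \<open>r\<close> with nonzero
  summand. It lies in \<open>{0, 1}\<close> for the diagrams to which the transition is applied, so the
  truncation by \<open>nat\<close> has no effect there.\<close>

definition excess :: "diagram \<Rightarrow> diagram \<Rightarrow> nat \<Rightarrow> nat" where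
  "excess \<kappa> \<mu> h = nat (\<Sum>r | r \<in># \<kappa> + \<mu> \<and> h < r. int (count \<mu> r) - int (count \<kappa> r))"

text \<open>The probability of \<open>(j, j')\<close> given \<open>(i, i')\<close> in the first step, with powers of \<open>u\<close> and \<open>v\<close>
  cancelled, so that it also makes sense for \<open>u = 0\<close> or \<open>v = 0\<close>. Where the weight \<open>R\<close> is
  nonzero, an exponent is negative only for \<open>i = i' = 1\<close>, \<open>j = j' = 0\<close>; there the factor
  \<open>u v\<close> in \<open>R\<^bsub>uv\<^esub>(0,0;1,1)\<close> cancels.\<close>

definition init_prob ::
    "real \<Rightarrow> real \<Rightarrow> real \<Rightarrow> nat \<Rightarrow> nat \<Rightarrow> nat \<Rightarrow> nat \<Rightarrow> real" where
  "init_prob q u v i i' j j' =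
    (if (i, i', j, j') = (1, 1, 0, 0) then (1 - q) / (1 - u * v)
     else v powi (int j' - int i) * u powi (int j - int i') * R q (u * v) j j' i' i) /
    ((1 - q * u * v) / (1 - u * v))"

lemma init_prob_eq:
  assumes "u \<noteq> 0" "v \<noteq> 0"
  shows "init_prob q u v i i' j j' =
    v ^ j' * u ^ j * R q (u * v) j j' i' i / ((1 - q * u * v) / (1 - u * v) * v ^ i * u ^ i')"
proof (cases "(i, i', j, j') = (1, 1, 0, 0)")
  case True
  then show ?thesis using assms by (simp add: init_prob_def R_def)
next
  case False
  show ?thesis
    unfolding init_prob_def if_not_P[OF False]
    using assms by (simp add: power_int_diff mult_ac)
qed

text \<open>The probability that the forward transition from \<open>\<kappa>\<close> given \<open>lam\<close> and \<open>\<mu>\<close> produces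
  \<open>j\<^sub>0, j'\<^sub>0, n\<^sub>1, j\<^sub>1, j'\<^sub>1, \<dots>, n\<^sub>H, j\<^sub>H, j'\<^sub>H\<close> in its first \<open>H\<close> steps.\<close>

definition forward_prob ::
    "real \<Rightarrow> couplings \<Rightarrow> real \<Rightarrow> real \<Rightarrow> diagram \<Rightarrow> diagram \<Rightarrow> diagram \<Rightarrow> nat \<Rightarrow>
     (nat \<Rightarrow> nat) \<Rightarrow> (nat \<Rightarrow> nat) \<Rightarrow> (nat \<Rightarrow> nat) \<Rightarrow> real" where
  "forward_prob q Q u v \<kappa> \<mu> lam H n j j' =
    (let i = excess \<kappa> \<mu>; i' = excess \<kappa> lam in
     init_prob q u v (i 0) (i' 0) (j 0) (j' 0) *
     (\<Prod>h=1..H. bij_prob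
        (Q u v (j (h - 1), j' (h - 1), count \<mu> h, i h, i' h, count lam h))
        (count \<kappa> h, i (h - 1), i' (h - 1))
        (n h, j h, j' h)))"

section \<open>The Yang--Baxter field\<close>

text \<open>\<open>\<Lambda> x y\<close> is the diagram at \<open>(x, y)\<close>, and \<open>J x y h\<close>, \<open>J' x y h\<close> are the auxiliary variables
  \<open>j\<^sub>h\<close>, \<open>j'\<^sub>h\<close> used in sampling it (\<open>n\<^sub>h\<close> is \<open>count (\<Lambda> x y) h\<close>). The last clause is the
  sequential sampling rule: given the diagrams at the vertices with \<open>x + y \<le> d\<close>, the variables at
  the vertices with \<open>x + y = d + 1\<close> are independent and follow the forward transition. As the
  sequences \<open>(n\<^sub>h, j\<^sub>h, j'\<^sub>h)\<^sub>h\<close> are infinite, the rule is stated for the first \<open>H\<close> steps, for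
  every \<open>H\<close>.\<close>

definition YB_field ::
    "real \<Rightarrow> couplings \<Rightarrow> (nat \<Rightarrow> real) \<Rightarrow> (nat \<Rightarrow> real) \<Rightarrow> 'w measure \<Rightarrow>
     (nat \<Rightarrow> nat \<Rightarrow> 'w \<Rightarrow> diagram) \<Rightarrow>
     (nat \<Rightarrow> nat \<Rightarrow> nat \<Rightarrow> 'w \<Rightarrow> nat) \<Rightarrow> (nat \<Rightarrow> nat \<Rightarrow> nat \<Rightarrow> 'w \<Rightarrow> nat) \<Rightarrow> bool" where
  "YB_field q Q u v M \<Lambda> J J' \<longleftrightarrow>
     prob_space M \<and>
     (\<forall>x y. \<Lambda> x y \<in> measurable M (count_space UNIV)) \<and>
     (\<forall>x\<ge>1. \<forall>y\<ge>1. \<forall>h. J x y h \<in> measurable M (count_space UNIV) \<and>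
                       J' x y h \<in> measurable M (count_space UNIV)) \<and>
     (\<forall>\<omega>\<in>space M. \<forall>x y. 0 \<notin># \<Lambda> x y \<omega>) \<and>
     (\<forall>\<omega>\<in>space M. \<forall>x. \<Lambda> x 0 \<omega> = {#}) \<and>
     (\<forall>\<omega>\<in>space M. \<forall>y. \<Lambda> 0 y \<omega> = {#}) \<and>
     (\<forall>x\<ge>1. \<forall>y\<ge>1. AE \<omega> in M. \<exists>H. \<forall>h\<ge>H. J x y h \<omega> = 0 \<and> J' x y h \<omega> = 0) \<and>
     (\<forall>d H. \<forall>\<sigma> :: nat \<Rightarrow> nat \<Rightarrow> diagram. \<forall>n j j' :: nat \<Rightarrow> nat \<Rightarrow> nat \<Rightarrow> nat.
        measure M {\<omega> \<in> space M.
            (\<forall>x y. x + y \<le> d \<longrightarrow> \<Lambda> x y \<omega> = \<sigma> x y) \<and>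
            (\<forall>x\<ge>1. \<forall>y\<ge>1. x + y = d + 1 \<longrightarrow>
               (\<forall>h\<le>H. J x y h \<omega> = j x y h \<and> J' x y h \<omega> = j' x y h) \<and>
               (\<forall>h\<in>{1..H}. count (\<Lambda> x y \<omega>) h = n x y h))} =
        measure M {\<omega> \<in> space M. \<forall>x y. x + y \<le> d \<longrightarrow> \<Lambda> x y \<omega> = \<sigma> x y} *
        (\<Prod>(x, y) \<in> {(x, y). 1 \<le> x \<and> 1 \<le> y \<and> x + y = d + 1}.
           forward_prob q Q (u y) (v x)
             (\<sigma> (x - 1) (y - 1)) (\<sigma> x (y - 1)) (\<sigma> (x - 1) y) H (n x y) (j x y) (j' x y)))"

section \<open>The stochastic six vertex model\<close>

definition L6V :: "real \<Rightarrow> real \<Rightarrow> nat \<Rightarrow> nat \<Rightarrow> nat \<Rightarrow> nat \<Rightarrow> real" where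
  "L6V q z i1 j1 i2 j2 =
    (if (i1, j1, i2, j2) = (0, 0, 0, 0) \<or> (i1, j1, i2, j2) = (1, 1, 1, 1) then 1
     else if (i1, j1, i2, j2) = (1, 0, 1, 0) then q * (1 - z) / (1 - q * z)
     else if (i1, j1, i2, j2) = (1, 0, 0, 1) then (1 - q) / (1 - q * z)
     else if (i1, j1, i2, j2) = (0, 1, 0, 1) then (1 - z) / (1 - q * z)
     else if (i1, j1, i2, j2) = (0, 1, 1, 0) then z * (1 - q) / (1 - q * z)
     else 0)"

text \<open>\<open>V x y\<close> and \<open>W x y\<close> are the numbers of paths on the vertical edge \<open>(x, y) \<rightarrow> (x, y + 1)\<close> and on
  the horizontal edge \<open>(x, y) \<rightarrow> (x + 1, y)\<close>. The vertex \<open>(x, y)\<close> thus has the configuration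
  \<open>(V x (y - 1), W (x - 1) y; V x y, W x y)\<close>. The last clause is the sequential sampling rule, as
  above.\<close>

definition six_vertex ::
    "real \<Rightarrow> (nat \<Rightarrow> real) \<Rightarrow> (nat \<Rightarrow> real) \<Rightarrow> 'w measure \<Rightarrow>
     (nat \<Rightarrow> nat \<Rightarrow> 'w \<Rightarrow> nat) \<Rightarrow> (nat \<Rightarrow> nat \<Rightarrow> 'w \<Rightarrow> nat) \<Rightarrow> bool" where
  "six_vertex q u v M V W \<longleftrightarrow>
     prob_space M \<and>
     (\<forall>x\<ge>1. \<forall>y. V x y \<in> measurable M (count_space UNIV)) \<and>
     (\<forall>x. \<forall>y\<ge>1. W x y \<in> measurable M (count_space UNIV)) \<and>
     (\<forall>\<omega>\<in>space M. (\<forall>x\<ge>1. \<forall>y. V x y \<omega> \<le> 1) \<and> (\<forall>x. \<forall>y\<ge>1. W x y \<omega> \<le> 1)) \<and>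
     (\<forall>\<omega>\<in>space M. \<forall>x\<ge>1. V x 0 \<omega> = 0) \<and>
     (\<forall>\<omega>\<in>space M. \<forall>y\<ge>1. W 0 y \<omega> = 1) \<and>
     (\<forall>d. \<forall>\<sigma> \<tau> :: nat \<Rightarrow> nat \<Rightarrow> nat.
        measure M {\<omega> \<in> space M.
            (\<forall>x\<ge>1. \<forall>y. x + y \<le> d + 1 \<longrightarrow> V x y \<omega> = \<sigma> x y) \<and>
            (\<forall>x. \<forall>y\<ge>1. x + y \<le> d + 1 \<longrightarrow> W x y \<omega> = \<tau> x y)} =
        measure M {\<omega> \<in> space M.
            (\<forall>x\<ge>1. \<forall>y. x + y \<le> d \<longrightarrow> V x y \<omega> = \<sigma> x y) \<and>
            (\<forall>x. \<forall>y\<ge>1. x + y \<le> d \<longrightarrow> W x y \<omega> = \<tau> x y)} *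
        (if \<sigma> (d + 1) 0 = 0 \<and> \<tau> 0 (d + 1) = 1 then 1 else 0) *
        (\<Prod>(x, y) \<in> {(x, y). 1 \<le> x \<and> 1 \<le> y \<and> x + y = d + 1}.
           L6V q (u y * v x) (\<sigma> x (y - 1)) (\<tau> (x - 1) y) (\<sigma> x y) (\<tau> x y)))"

text \<open>The height function is defined for \<open>x \<ge> 1\<close>: the paths passing weakly to the right of
  \<open>(x, y)\<close> are those crossing the vertical line between \<open>x - 1\<close> and \<open>x\<close> at level at most \<open>y\<close>.\<close>

definition height6V :: "(nat \<Rightarrow> nat \<Rightarrow> 'w \<Rightarrow> nat) \<Rightarrow> nat \<Rightarrow> nat \<Rightarrow> 'w \<Rightarrow> nat" where
  "height6V W x y \<omega> = card {k \<in> {1..y}. W (x - 1) k \<omega> = 1}"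

end

theory Submission
  imports Defs
begin

text \<open>The length \<open>\<ell>(\<lambda>\<^bsup>(x,y)\<^esup>)\<close> grows by \<open>j\<^sub>0\<close> when \<open>y\<close> increases and by \<open>j'\<^sub>0\<close> when \<open>x\<close> increases, and
  \<open>(j\<^sub>0, j'\<^sub>0)\<close> is chosen in the first step of the forward transition, with a law that depends on the
  diagrams only through the length differences \<open>i\<^sub>0, i'\<^sub>0\<close>. After complementing the horizontal
  variables this law is \<open>L6V\<close>, so the lengths form a Markov field of their own, sampled by the same
  rule as the height function. The couplings enter only through their supports: path conservation
  at every vertex of nonzero weight makes \<open>n\<^sub>h - m\<^sub>h\<close> and \<open>n\<^sub>h - l\<^sub>h\<close> telescope, provided that almost
  surely only Yang--Baxter equations with positive sides are met.\<close>

section \<open>Supports of the vertex weights and couplings\<close>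

text \<open>\<open>Q\<close> is arbitrary at boundary data where a side of the Yang-Baxter equation
  vanishes, so the length formulas cannot be proved one transition at a time: an invariant must
  travel through the whole field, and inside each transition through all columns, to keep the
  process where \<open>Q\<close> is constrained. This is why the columns h >= 1 have to be followed
  although the law of the lengths is decided at h = 0.

  The complement comes from the height y - l: a unit step in y raises it by 1 - j_0, a unit step in
  x lowers it by j'_0. The horizontal edge therefore carries 1 - j_0 and the vertical edge j'_0.

  The sampling rule conditions on entire diagrams and prescribes auxiliary variables, not lengths.
  Hence two translations: almost surely the lengths on a new layer are functions of the old ones and
  of j_0, j'_0; and the rule is summed over all diagrams with prescribed lengths, on which the
  transition probability is constant. Both fields then obey one recursion over the triangles x + y
  <= d, which fixes the finite-dimensional laws.\<close>

lemma w_nonzero_iff: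
  assumes "0 < q" "q < 1" "- 1 < s" "s < 0" "0 \<le> u" "u < 1"
  shows "w q s u i1 j1 i2 j2 \<noteq> 0 \<longleftrightarrow>
    j1 = 0 \<and> j2 = 0 \<and> i2 = i1 \<or> j1 = 0 \<and> j2 = 1 \<and> i1 = i2 + 1 \<and> u \<noteq> 0 \<or>
    j1 = 1 \<and> j2 = 1 \<and> i2 = i1 \<or> j1 = 1 \<and> j2 = 0 \<and> i2 = i1 + 1"
    and w_nonneg: "0 \<le> w q s u i1 j1 i2 j2"
proof -
  have su: "s * u \<le> 0" using assms by (simp add: mult_nonpos_nonneg)
  have a: "1 - s * u * q ^ i > 0" for i
  proof -
    have "s * u * q ^ i \<le> 0" using su assms by (simp add: mult_nonpos_nonneg)
    then show ?thesis by simp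
  qed
  have q1: "q ^ i \<le> 1" for i using assms by (simp add: power_le_one)
  have s2: "s\<^sup>2 < 1" using assms by (simp add: abs_square_less_1)
  have b: "1 - s\<^sup>2 * q ^ i > 0" for i
  proof -
    have "s\<^sup>2 * q ^ i \<le> s\<^sup>2 * 1" using q1 by (intro mult_left_mono) auto
    then show ?thesis using s2 by simp
  qed
  \<comment> \<open>Strictness of \<open>s < 0\<close> keeps this weight positive at
    \<open>u = 0\<close> as well; among the four kinds of vertices only (g+1,0;g,1) is lost
    there.\<close>
  have c: "u - s * q ^ i > 0" for i
  proof -
    have "s * q ^ i < 0" using assms by (simp add: mult_neg_pos)
    then show ?thesis using assms by simp
  qed
  have d: "1 - q ^ (i + 1) > 0" for i
    using assms power_Suc_less_one[of q i] by simp
  have e: "1 - s * u > 0" using su by simp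
  show "w q s u i1 j1 i2 j2 \<noteq> 0 \<longleftrightarrow>
    j1 = 0 \<and> j2 = 0 \<and> i2 = i1 \<or> j1 = 0 \<and> j2 = 1 \<and> i1 = i2 + 1 \<and> u \<noteq> 0 \<or>
    j1 = 1 \<and> j2 = 1 \<and> i2 = i1 \<or> j1 = 1 \<and> j2 = 0 \<and> i2 = i1 + 1"
    unfolding w_def using less_imp_neq[OF a] less_imp_neq[OF b] less_imp_neq[OF c]
      less_imp_neq[OF d] less_imp_neq[OF e] by (auto simp: eq_commute[of 0])
  show "0 \<le> w q s u i1 j1 i2 j2"
    unfolding w_def using less_imp_le[OF a] less_imp_le[OF b] less_imp_le[OF c]
      less_imp_le[OF d] less_imp_le[OF e] assms
    by (auto intro!: divide_nonneg_nonneg mult_nonneg_nonneg)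
qed

lemma mult_less_one:
  fixes u v :: real
  assumes "0 \<le> u" "u < 1" "0 \<le> v" "v < 1"
  shows "u * v < 1"
  using mult_strict_mono'[of u 1 v 1] assms by simp

lemma R_nonzero_iff:
  assumes "0 < q" "q < 1" "0 \<le> z" "z < 1"
  shows "R q z i1 j1 i2 j2 \<noteq> 0 \<longleftrightarrow>
    i1 \<le> 1 \<and> j1 \<le> 1 \<and> i2 = i1 \<and> j2 = j1 \<or>
    i1 = 1 \<and> j1 = 1 \<and> i2 = 0 \<and> j2 = 0 \<or>
    i1 = 0 \<and> j1 = 0 \<and> i2 = 1 \<and> j2 = 1 \<and> z \<noteq> 0"
    and R_nonneg: "0 \<le> R q z i1 j1 i2 j2"
proof -
  have "q * z < 1" using assms by (intro mult_less_one) auto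
  with assms show "R q z i1 j1 i2 j2 \<noteq> 0 \<longleftrightarrow>
    i1 \<le> 1 \<and> j1 \<le> 1 \<and> i2 = i1 \<and> j2 = j1 \<or>
    i1 = 1 \<and> j1 = 1 \<and> i2 = 0 \<and> j2 = 0 \<or>
    i1 = 0 \<and> j1 = 0 \<and> i2 = 1 \<and> j2 = 1 \<and> z \<noteq> 0"
    and "0 \<le> R q z i1 j1 i2 j2"
    unfolding R_def by (auto simp: le_Suc_eq)
qed

lemma qpoch_pos:
  assumes "0 < q" "q < 1" "a < 1" "0 \<le> a"
  shows "0 < qpoch a q k"
  unfolding qpoch_def
proof (rule prod_pos)
  fix i
  have "a * q ^ (i - 1) \<le> a * 1" using assms by (intro mult_left_mono power_le_one) auto
  then show "0 < 1 - a * q ^ (i - 1)" using assms by simp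
qed

text \<open>Up to a positive ratio of q-Pochhammer symbols, \<open>wstar\<close> is \<open>w\<close>
  with the vertical arguments exchanged. Signs and supports do not see this ratio, so it is hidden
  in \<open>C\<close>.\<close>

lemma wstar_eq:
  assumes "0 < q" "q < 1" "- 1 < s" "s < 0"
  obtains C where "C > 0" "wstar q s v i1 j1 i2 j2 = C * w q s v i2 j1 i1 j2"
proof -
  have "s\<^sup>2 < 1" using assms by (simp add: abs_square_less_1)
  then have a: "0 < qpoch (s\<^sup>2) q k" for k using assms by (intro qpoch_pos) auto
  have "0 < qpoch q q k" for k using assms by (intro qpoch_pos) auto
  with a show ?thesis
    by (intro that[of "(qpoch (s\<^sup>2) q i1 * qpoch q q i2) / (qpoch q q i1 * qpoch (s\<^sup>2) q i2)"])
      (auto simp: wstar_def)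
qed

lemma wstar_nonneg:
  assumes "0 < q" "q < 1" "- 1 < s" "s < 0" "0 \<le> v" "v < 1"
  shows "0 \<le> wstar q s v i1 j1 i2 j2"
  by (rule wstar_eq[OF assms(1-4), of v i1 j1 i2 j2]) (use w_nonneg[OF assms] in auto)

lemma wstar_nonzero_iff:
  assumes "0 < q" "q < 1" "- 1 < s" "s < 0"
  shows "wstar q s v i1 j1 i2 j2 \<noteq> 0 \<longleftrightarrow> w q s v i2 j1 i1 j2 \<noteq> 0"
  by (rule wstar_eq[OF assms, of v i1 j1 i2 j2]) auto

section \<open>Signs and supports of the Yang-Baxter summands\<close>

lemma YB_left_nonneg:
  assumes "0 < q" "q < 1" "- 1 < s" "s < 0" "0 \<le> u" "u < 1" "0 \<le> v" "v < 1"
  shows "0 \<le> YB_left q s u v c x"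
  using wstar_nonneg[OF assms(1-4,7,8)] w_nonneg[OF assms(1-6)]
    R_nonneg[OF assms(1,2), of "u * v"] assms mult_less_one[of u v]
  by (cases c; cases x) (auto simp: YB_left_def intro!: mult_nonneg_nonneg)

lemma YB_right_nonneg:
  assumes "0 < q" "q < 1" "- 1 < s" "s < 0" "0 \<le> u" "u < 1" "0 \<le> v" "v < 1"
  shows "0 \<le> YB_right q s u v c x"
  using wstar_nonneg[OF assms(1-4,7,8)] w_nonneg[OF assms(1-6)]
    R_nonneg[OF assms(1,2), of "u * v"] assms mult_less_one[of u v]
  by (cases c; cases x) (auto simp: YB_right_def intro!: mult_nonneg_nonneg)

lemma YB_left_nonzero_iff:
  assumes "0 < q" "q < 1" "- 1 < s" "s < 0"
  shows "YB_left q s u v (a, a', m, b, b', l) (k, p, p') \<noteq> 0 \<longleftrightarrow>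
    R q (u * v) a a' p' p \<noteq> 0 \<and> w q s v k p m b \<noteq> 0 \<and> w q s u k p' l b' \<noteq> 0"
  unfolding YB_left_def by (simp add: wstar_nonzero_iff[OF assms])

lemma YB_right_nonzero_iff:
  assumes "0 < q" "q < 1" "- 1 < s" "s < 0"
  shows "YB_right q s u v (a, a', m, b, b', l) (n, t, t') \<noteq> 0 \<longleftrightarrow>
    w q s v l a' n t' \<noteq> 0 \<and> w q s u m a n t \<noteq> 0 \<and> R q (u * v) t t' b' b \<noteq> 0"
  unfolding YB_right_def by (simp add: wstar_nonzero_iff[OF assms])

text \<open>\<open>infsum\<close> returns 0 on a family that is not summable, so a nonzero term
  among nonnegative ones does not suffice; finite support makes the sum an ordinary one.\<close>

lemma infsum_pos_finite_support:
  fixes f :: "'a \<Rightarrow> real"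
  assumes "finite S" "\<And>x. x \<notin> S \<Longrightarrow> f x = 0" "\<And>x. 0 \<le> f x" "f x \<noteq> 0"
  shows "0 < (\<Sum>\<^sub>\<infinity>x. f x)"
proof -
  have "(\<Sum>\<^sub>\<infinity>x. f x) = (\<Sum>x\<in>S. f x)"
    using assms(1,2) by (subst infsum_finite[OF assms(1), symmetric]) (intro infsum_cong_neutral, auto)
  also have "\<dots> > 0"
    using assms by (intro sum_pos2[of S x]) (auto simp: less_le)
  finally show ?thesis .
qed

lemma YB_left_sum_pos:
  assumes "0 < q" "q < 1" "- 1 < s" "s < 0" "0 \<le> u" "u < 1" "0 \<le> v" "v < 1"
    and "YB_left q s u v c x \<noteq> 0"
  shows "0 < YB_left_sum q s u v c"
proof -
  obtain a a' m b b' l where c: "c = (a, a', m, b, b', l)" by (cases c)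
  show ?thesis unfolding YB_left_sum_def
  \<comment> \<open>A vertex of nonzero weight changes the vertical occupation by at most one and
    has horizontal occupations in {0,1}. Since \<open>k\<close> and \<open>m\<close> meet at one
    vertex, \<open>k\<close> is at most \<open>m + 1\<close>.\<close>
  proof (rule infsum_pos_finite_support[where S = "{..m + 1} \<times> {..1} \<times> {..1}"])
    fix y :: state assume y: "y \<notin> {..m + 1} \<times> {..1} \<times> {..1::nat}"
    obtain k p p' where [simp]: "y = (k, p, p')" by (cases y)
    from y show "YB_left q s u v c y = 0"
      using YB_left_nonzero_iff[OF assms(1-4), of u v a a' m b b' l k p p']
        w_nonzero_iff[OF assms(1-4,7,8), of k p m b] w_nonzero_iff[OF assms(1-6), of k p' l b']
      unfolding c by (auto simp: le_Suc_eq)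
  qed (use assms YB_left_nonneg in auto)
qed

lemma YB_right_sum_pos:
  assumes "0 < q" "q < 1" "- 1 < s" "s < 0" "0 \<le> u" "u < 1" "0 \<le> v" "v < 1"
    and "YB_right q s u v c x \<noteq> 0"
  shows "0 < YB_right_sum q s u v c"
proof -
  obtain a a' m b b' l where c: "c = (a, a', m, b, b', l)" by (cases c)
  show ?thesis unfolding YB_right_sum_def
  proof (rule infsum_pos_finite_support[where S = "{..m + 1} \<times> {..1} \<times> {..1}"])
    fix y :: state assume y: "y \<notin> {..m + 1} \<times> {..1} \<times> {..1::nat}"
    obtain n t t' where [simp]: "y = (n, t, t')" by (cases y)
    from y show "YB_right q s u v c y = 0"
      using YB_right_nonzero_iff[OF assms(1-4), of u v a a' m b b' l n t t']
        w_nonzero_iff[OF assms(1-4,7,8), of l a' n t'] w_nonzero_iff[OF assms(1-6), of m a n t]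
      unfolding c by (auto simp: le_Suc_eq)
  qed (use assms YB_right_nonneg in auto)
qed

text \<open>All that is needed of the Yang--Baxter equation: if the left-hand side is positive, so is the
  right-hand side.\<close>

lemma YB_right_nonzero_ex:
  assumes par: "0 < q" "q < 1" "- 1 < s" "s < 0" "0 \<le> u" "u < 1" "0 \<le> v" "v < 1"
    and "YB_left q s u v (a, a', m, b, b', l) (k, p, p') \<noteq> 0"
  shows "\<exists>y. YB_right q s u v (a, a', m, b, b', l) y \<noteq> 0"
proof -
  note W = w_nonzero_iff[OF par(1-6)] w_nonzero_iff[OF par(1-4,7,8)]
    R_nonzero_iff[OF par(1,2) mult_nonneg_nonneg[OF par(5,7)] mult_less_one[OF par(5-8)]]
  let ?P = "\<lambda>n t t'. w q s v l a' n t' \<noteq> 0 \<and> w q s u m a n t \<noteq> 0 \<and> R q (u * v) t t' b' b \<noteq> 0"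
  have r: "R q (u * v) a a' p' p \<noteq> 0" and w1: "w q s v k p m b \<noteq> 0" and w2: "w q s u k p' l b' \<noteq> 0"
    using assms(9) unfolding YB_left_nonzero_iff[OF par(1-4)] by auto
  \<comment> \<open>Conservation \<open>m + a = n + t\<close> fixes \<open>n\<close> in each
    candidate. The pair \<open>(t, t')\<close> either passes the cross vertex unchanged, giving
    \<open>(b', b)\<close>, or is (0,0) or (1,1), in case the first choice asks for a negative
    \<open>n\<close> or for a vertex whose weight vanishes with a parameter.\<close>
  have "?P (m + a - b') b' b \<or> ?P (m + a) 0 0 \<or> ?P (m + a - 1) 1 1"
    using r[unfolded W]
  proof (elim disjE)
    assume "a \<le> 1 \<and> a' \<le> 1 \<and> p' = a \<and> p = a'"
    then show ?thesis using w1 w2 unfolding W by (elim disjE conjE; simp)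
  next
    assume "a = 1 \<and> a' = 1 \<and> p' = 0 \<and> p = 0"
    then show ?thesis using w1 w2 unfolding W by (elim disjE conjE; simp)
  next
    assume "a = 0 \<and> a' = 0 \<and> p' = 1 \<and> p = 1 \<and> u * v \<noteq> 0"
    then show ?thesis using w1 w2 unfolding W by (elim disjE conjE; simp)
  qed
  then show ?thesis
    using YB_right_nonzero_iff[OF par(1-4), of u v a a' m b b' l] by blast
qed

text \<open>The nonzero left summand makes both sums positive, by
  \<open>YB_right_nonzero_ex\<close>, and puts \<open>a, a', b, b'\<close> in {0,1}, so
  \<open>Q\<close> is a genuine coupling at this datum. A transition of nonzero conditional
  probability has positive joint mass, and its target then has positive mass in the second
  marginal.\<close>

lemma coupling_support:
  assumes par: "0 < q" "q < 1" "- 1 < s" "s < 0" "0 \<le> u" "u < 1" "0 \<le> v" "v < 1"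
    and Q: "bijectivization q s u v Q"
    and left: "YB_left q s u v (a, a', m, b, b', l) (k, p, p') \<noteq> 0"
    and bij: "bij_prob (Q u v (a, a', m, b, b', l)) (k, p, p') (n, t, t') \<noteq> 0"
  shows "YB_right q s u v (a, a', m, b, b', l) (n, t, t') \<noteq> 0"
proof -
  let ?c = "(a, a', m, b, b', l)"
  have bd: "a \<in> {0, 1}" "a' \<in> {0, 1}" "b \<in> {0, 1}" "b' \<in> {0, 1}"
    using left unfolding YB_left_nonzero_iff[OF par(1-4)]
      w_nonzero_iff[OF par(1-6)] w_nonzero_iff[OF par(1-4,7,8)]
      R_nonzero_iff[OF par(1,2) mult_nonneg_nonneg[OF par(5,7)] mult_less_one[OF par(5-8)]]
    by (auto simp: le_Suc_eq)
  obtain y where y: "YB_right q s u v ?c y \<noteq> 0" using YB_right_nonzero_ex[OF par left] by blast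
  have "is_coupling q s u v ?c (Q u v ?c)"
    using Q bd YB_left_sum_pos[OF par left] YB_right_sum_pos[OF par y]
    unfolding bijectivization_def Let_def by blast
  then have "pmf (map_pmf snd (Q u v ?c)) (n, t, t') =
      YB_right q s u v ?c (n, t, t') / YB_right_sum q s u v ?c"
    unfolding is_coupling_def by blast
  moreover have "((k, p, p'), (n, t, t')) \<in> set_pmf (Q u v ?c)"
    using bij unfolding bij_prob_def by (auto simp: set_pmf_iff)
  then have "(n, t, t') \<in> set_pmf (map_pmf snd (Q u v ?c))" by force
  then have "pmf (map_pmf snd (Q u v ?c)) (n, t, t') \<noteq> 0" by (rule set_pmf_iff[THEN iffD1])
  ultimately show ?thesis by auto
qed

section \<open>The forward transition on its support\<close>

lemma size_diff:
  fixes \<kappa> \<mu> :: diagram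
  assumes "0 \<notin># \<kappa>" "0 \<notin># \<mu>"
  shows "(\<Sum>r | r \<in># \<kappa> + \<mu> \<and> 0 < r. int (count \<mu> r) - int (count \<kappa> r)) =
    int (size \<mu>) - int (size \<kappa>)"
proof -
  let ?S = "{r. r \<in># \<kappa> + \<mu> \<and> 0 < r}"
  have "0 < r" if "r \<in># \<kappa> + \<mu>" for r using assms that by (cases r) auto
  then have S: "?S = set_mset (\<kappa> + \<mu>)" by blast
  have "size \<kappa> = (\<Sum>r\<in>?S. count \<kappa> r)" "size \<mu> = (\<Sum>r\<in>?S. count \<mu> r)"
    unfolding S size_multiset_overloaded_eq
    by (auto intro!: sum.mono_neutral_left simp: not_in_iff)
  then show ?thesis by (simp add: sum_subtractf)
qed

lemma excess_0:
  assumes "0 \<notin># \<kappa>" "0 \<notin># \<mu>"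
  shows "excess \<kappa> \<mu> 0 = nat (int (size \<mu>) - int (size \<kappa>))"
  unfolding excess_def by (simp only: size_diff[OF assms])

text \<open>By conservation the term at \<open>r\<close> equals \<open>e (r - 1) - e r\<close>, so
  the sum collapses to \<open>e h\<close> minus the eventual value of \<open>e\<close>, which is 0.
  This is where the requirement that j_h and j'_h vanish for large h enters.\<close>

lemma excess_telescope:
  fixes \<kappa> \<mu> :: diagram
  assumes e0: "\<And>h. H \<le> h \<Longrightarrow> e h = 0"
    and step: "\<And>h. 1 \<le> h \<Longrightarrow> count \<kappa> h + e (h - 1) = count \<mu> h + e h"
  shows "(\<Sum>r | r \<in># \<kappa> + \<mu> \<and> h < r. int (count \<mu> r) - int (count \<kappa> r)) = int (e h)"
proof -
  obtain K where K: "\<And>r. r \<in># \<kappa> + \<mu> \<Longrightarrow> r \<le> K"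
    using finite_nat_set_iff_bounded_le[of "set_mset (\<kappa> + \<mu>)"] by auto
  \<comment> \<open>Beyond \<open>K\<close> no parts are left, and from \<open>H\<close> on the
    sequence \<open>e\<close> is 0.\<close>
  define N where "N = Max {K, H, h}"
  have N: "K \<le> N" "H \<le> N" "h \<le> N" unfolding N_def by auto
  have tel: "(\<Sum>r\<in>{h<..n}. int (count \<mu> r) - int (count \<kappa> r)) = int (e h) - int (e n)"
    if "h \<le> n" for n
    using that
  proof (induction n rule: dec_induct)
    case (step n)
    then have "{h<..Suc n} = insert (Suc n) {h<..n}" by auto
    then show ?case
      using step assms(2)[of "Suc n"] by simp
  qed simp
  have "(\<Sum>r | r \<in># \<kappa> + \<mu> \<and> h < r. int (count \<mu> r) - int (count \<kappa> r)) =
        (\<Sum>r\<in>{h<..N}. int (count \<mu> r) - int (count \<kappa> r))"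
    using N K by (intro sum.mono_neutral_left) (force simp: not_in_iff)+
  then show ?thesis
    using tel[OF N(3)] e0[OF N(2)] by simp
qed

text \<open>Invariant of the field along each unit step: \<open>\<kappa>\<close> and \<open>\<mu>\<close> are joined by a row of vertices
  of nonzero weight. The clause for \<open>v = 0\<close> excludes \<open>i\<^sub>0 = i'\<^sub>0 = 1\<close>, \<open>j\<^sub>0 = j'\<^sub>0 = 0\<close> when \<open>u v = 0\<close>,
  the only case in which the initial step has positive probability although \<open>R\<close> vanishes.\<close>

definition strip :: "real \<Rightarrow> real \<Rightarrow> real \<Rightarrow> diagram \<Rightarrow> diagram \<Rightarrow> bool" where
  "strip q s v \<kappa> \<mu> \<longleftrightarrow>
     (\<forall>h\<ge>1. w q s v (count \<kappa> h) (excess \<kappa> \<mu> (h - 1)) (count \<mu> h) (excess \<kappa> \<mu> h) \<noteq> 0) \<and>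
     size \<mu> = size \<kappa> + excess \<kappa> \<mu> 0 \<and> (v = 0 \<longrightarrow> excess \<kappa> \<mu> 0 = 0)"

lemma strip_empty:
  assumes "0 < q" "q < 1" "- 1 < s" "s < 0" "0 \<le> v" "v < 1"
  shows "strip q s v {#} {#}"
  unfolding strip_def w_nonzero_iff[OF assms] by (simp add: excess_def)

text \<open>Identifies the auxiliary variables of a transition with the excesses of the new diagram:
  nonzero vertex weights and eventually zero horizontal occupations leave no other choice for them.
  In later transitions these excesses are the inputs i_h, i'_h.\<close>

lemma stripI:
  assumes par: "0 < q" "q < 1" "- 1 < s" "s < 0" "0 \<le> v" "v < 1"
    and zero: "0 \<notin># \<kappa>" "0 \<notin># \<mu>"
    and e0: "\<And>h. H \<le> h \<Longrightarrow> e h = 0"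
    and w: "\<And>h. 1 \<le> h \<Longrightarrow> w q s v (count \<kappa> h) (e (h - 1)) (count \<mu> h) (e h) \<noteq> 0"
    and v0: "v = 0 \<Longrightarrow> e 0 = 0"
  shows "strip q s v \<kappa> \<mu>" "excess \<kappa> \<mu> = e"
proof -
  have "count \<kappa> h + e (h - 1) = count \<mu> h + e h" if "1 \<le> h" for h
    using w[OF that] unfolding w_nonzero_iff[OF par] by auto
  note tel = excess_telescope[where e = e and H = H, OF e0 this]
  from tel show e: "excess \<kappa> \<mu> = e" by (simp add: fun_eq_iff excess_def)
  have "size \<mu> = size \<kappa> + e 0"
    using tel[of 0] size_diff[OF zero] by simp
  with w v0 show "strip q s v \<kappa> \<mu>" unfolding strip_def e by blast
qed

text \<open>Away from \<open>(i, i', j, j') = (1, 1, 0, 0)\<close> the initial weight is a multiple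
  of \<open>R\<close>; at that point the hypotheses make both parameters nonzero. If
  \<open>v = 0\<close>, then \<open>i = 0\<close> leaves the factor \<open>0 powi j'\<close>, which
  is nonzero only for \<open>j' = 0\<close>, and similarly for \<open>u\<close>; so the
  zero-parameter clause of \<open>strip\<close> is inherited.\<close>

lemma init_prob_nonzero:
  assumes par: "0 < q" "q < 1" "0 \<le> u" "u < 1" "0 \<le> v" "v < 1"
    and p: "init_prob q u v i i' j j' \<noteq> 0"
    and i: "v = 0 \<Longrightarrow> i = 0" "u = 0 \<Longrightarrow> i' = 0"
  shows "R q (u * v) j j' i' i \<noteq> 0" "v = 0 \<Longrightarrow> j' = 0" "u = 0 \<Longrightarrow> j = 0"
proof -
  have z: "u * v < 1" using par by (intro mult_less_one) auto
  show "R q (u * v) j j' i' i \<noteq> 0"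
  proof (cases "(i, i', j, j') = (1, 1, 0, 0)")
    case True
    with i have "u \<noteq> 0" "v \<noteq> 0" by auto
    with True par z show ?thesis by (simp add: R_def)
  next
    case False
    with p show ?thesis unfolding init_prob_def if_not_P[OF False] by auto
  qed
  show "j' = 0" if v: "v = 0"
    using p i(1)[OF v] v by (auto simp: init_prob_def split: if_splits)
  show "j = 0" if u: "u = 0"
    using p i(2)[OF u] u by (auto simp: init_prob_def split: if_splits)
qed

text \<open>The cross vertex is dragged through the columns. In column h the old strips supply the
  two vertex weights of the left summand, and the preceding column (for h = 1 the initial step)
  supplies its cross weight. The coupling passes to a nonzero right summand, which contains the
  vertices of the two new strips and the cross weight for the next column.\<close>

lemma forward_strip:
  assumes par: "0 < q" "q < 1" "- 1 < s" "s < 0" "0 \<le> u" "u < 1" "0 \<le> v" "v < 1"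
    and Q: "bijectivization q s u v Q"
    and zero: "0 \<notin># \<mu>" "0 \<notin># lam" "0 \<notin># \<nu>"
    and strips: "strip q s v \<kappa> \<mu>" "strip q s u \<kappa> lam"
    and j0: "\<And>h. H \<le> h \<Longrightarrow> j h = 0 \<and> j' h = 0"
    and fp: "\<And>H. forward_prob q Q u v \<kappa> \<mu> lam H (count \<nu>) j j' \<noteq> 0"
  shows "strip q s v lam \<nu>" "strip q s u \<mu> \<nu>"
    "size \<nu> = size \<mu> + j 0" "size \<nu> = size lam + j' 0" "j 0 \<le> 1" "j' 0 \<le> 1"
proof -
  define i i' where ii: "i = excess \<kappa> \<mu>" "i' = excess \<kappa> lam"
  define c where "c h = (j (h - 1), j' (h - 1), count \<mu> h, i h, i' h, count lam h)" for h
  note Rnz = R_nonzero_iff[OF par(1,2) mult_nonneg_nonneg[OF par(5,7)] mult_less_one[OF par(5-8)]]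
  have wv: "w q s v (count \<kappa> h) (i (h - 1)) (count \<mu> h) (i h) \<noteq> 0"
    and wu: "w q s u (count \<kappa> h) (i' (h - 1)) (count lam h) (i' h) \<noteq> 0" if "1 \<le> h" for h
    using strips that unfolding strip_def ii by blast+
  have i0: "v = 0 \<Longrightarrow> i 0 = 0" "u = 0 \<Longrightarrow> i' 0 = 0"
    using strips unfolding strip_def ii by blast+
  have init: "init_prob q u v (i 0) (i' 0) (j 0) (j' 0) \<noteq> 0"
    using fp[of 0] unfolding forward_prob_def Let_def ii by (rule contrapos_nn) (simp only: mult_zero_left)
  have bij: "bij_prob (Q u v (c h)) (count \<kappa> h, i (h - 1), i' (h - 1)) (count \<nu> h, j h, j' h) \<noteq> 0"
    if "1 \<le> h" for h
  proof -
    have "(\<Prod>h=1..h. bij_prob (Q u v (c h)) (count \<kappa> h, i (h - 1), i' (h - 1))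
        (count \<nu> h, j h, j' h)) \<noteq> 0"
      using fp[of h] unfolding forward_prob_def Let_def ii c_def by (rule contrapos_nn) (simp only: mult_zero_right)
    then have "\<forall>h\<in>{1..h}. bij_prob (Q u v (c h)) (count \<kappa> h, i (h - 1), i' (h - 1))
        (count \<nu> h, j h, j' h) \<noteq> 0"
      by (subst (asm) prod_zero_iff) blast+
    then show ?thesis using that by (meson atLeastAtMost_iff order_refl)
  qed
  note init' = init_prob_nonzero[OF par(1,2,5-8) init i0]
  have right: "YB_right q s u v (c h) (count \<nu> h, j h, j' h) \<noteq> 0"
    if h: "1 \<le> h" and r: "R q (u * v) (j (h - 1)) (j' (h - 1)) (i' (h - 1)) (i (h - 1)) \<noteq> 0" for h
    unfolding c_def
  proof (rule coupling_support[OF par Q _ bij[OF h, unfolded c_def]])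
    show "YB_left q s u v (j (h - 1), j' (h - 1), count \<mu> h, i h, i' h, count lam h)
      (count \<kappa> h, i (h - 1), i' (h - 1)) \<noteq> 0"
      unfolding YB_left_nonzero_iff[OF par(1-4)] using r wv[OF h] wu[OF h] by blast
  qed
  have r: "R q (u * v) (j h) (j' h) (i' h) (i h) \<noteq> 0" for h
  proof (induction h)
    case (Suc h)
    with right[of "Suc h"] show ?case
      unfolding c_def YB_right_nonzero_iff[OF par(1-4)] by simp
  qed (use init' in simp)
  have w': "w q s v (count lam h) (j' (h - 1)) (count \<nu> h) (j' h) \<noteq> 0"
    "w q s u (count \<mu> h) (j (h - 1)) (count \<nu> h) (j h) \<noteq> 0" if "1 \<le> h" for h
    using right[OF that r] unfolding c_def YB_right_nonzero_iff[OF par(1-4)] by auto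
  have jH: "\<And>h. H \<le> h \<Longrightarrow> j h = 0" "\<And>h. H \<le> h \<Longrightarrow> j' h = 0" using j0 by auto
  show A: "strip q s v lam \<nu>" by (rule stripI(1)[OF par(1-4,7,8) zero(2,3) jH(2) w'(1) init'(2)])
  have "excess lam \<nu> = j'" by (rule stripI(2)[OF par(1-4,7,8) zero(2,3) jH(2) w'(1) init'(2)])
  then show "size \<nu> = size lam + j' 0" using A unfolding strip_def by metis
  show B: "strip q s u \<mu> \<nu>" by (rule stripI(1)[OF par(1-6) zero(1,3) jH(1) w'(2) init'(3)])
  have "excess \<mu> \<nu> = j" by (rule stripI(2)[OF par(1-6) zero(1,3) jH(1) w'(2) init'(3)])
  then show "size \<nu> = size \<mu> + j 0" using B unfolding strip_def by metis
  show "j 0 \<le> 1" "j' 0 \<le> 1" using r[of 0] unfolding Rnz by (elim disjE conjE; linarith)+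
qed

text \<open>Dictionary: vertical input and output are i_0 and j'_0, the horizontal ones are 1 - i'_0
  and 1 - j_0. Division by (1 - quv)/(1 - uv) makes the weights stochastic, and the separate clause
  of \<open>init_prob\<close> becomes the entry (1,0;0,1) of \<open>L6V\<close>.\<close>

lemma init_prob_L6V:
  assumes par: "0 < q" "q < 1" "0 \<le> u" "u < 1" "0 \<le> v" "v < 1"
    and le: "i1 \<le> 1" "j1 \<le> 1" "i2 \<le> 1" "j2 \<le> 1"
  shows "init_prob q u v i1 (1 - j1) (1 - j2) i2 = L6V q (u * v) i1 j1 i2 j2"
proof -
  have "u * v < 1" using par by (intro mult_less_one) auto
  moreover have "q * (u * v) < 1" using par calculation by (intro mult_less_one) auto
  ultimately have nz: "1 - u * v \<noteq> 0" "1 - q * u * v \<noteq> 0" "1 - q * (u * v) \<noteq> 0"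
    by (auto simp: mult.assoc)
  have "i1 = 0 \<or> i1 = 1" "j1 = 0 \<or> j1 = 1" "i2 = 0 \<or> i2 = 1" "j2 = 0 \<or> j2 = 1"
    using le by auto
  then show ?thesis
  proof (elim disjE)
    assume *: "i1 = 0" "j1 = 0" "i2 = 0" "j2 = 0"
    show ?thesis unfolding * init_prob_def L6V_def R_def using nz by (simp add: mult.assoc)
  next
    assume *: "i1 = 0" "j1 = 0" "i2 = 0" "j2 = 1"
    show ?thesis unfolding * init_prob_def L6V_def R_def using nz by (simp add: mult.assoc)
  next
    assume *: "i1 = 0" "j1 = 0" "i2 = 1" "j2 = 0"
    show ?thesis unfolding * init_prob_def L6V_def R_def using nz by (simp add: mult.assoc)
  next
    assume *: "i1 = 0" "j1 = 0" "i2 = 1" "j2 = 1"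
    show ?thesis unfolding * init_prob_def L6V_def R_def using nz by (simp add: mult.assoc)
  next
    assume *: "i1 = 0" "j1 = 1" "i2 = 0" "j2 = 0"
    show ?thesis unfolding * init_prob_def L6V_def R_def using nz by (simp add: mult.assoc)
  next
    assume *: "i1 = 0" "j1 = 1" "i2 = 0" "j2 = 1"
    show ?thesis unfolding * init_prob_def L6V_def R_def using nz by (simp add: mult.assoc)
  next
    assume *: "i1 = 0" "j1 = 1" "i2 = 1" "j2 = 0"
    show ?thesis unfolding * init_prob_def L6V_def R_def using nz by (simp add: mult.assoc)
  next
    assume *: "i1 = 0" "j1 = 1" "i2 = 1" "j2 = 1"
    show ?thesis unfolding * init_prob_def L6V_def R_def using nz by (simp add: mult.assoc)
  next
    assume *: "i1 = 1" "j1 = 0" "i2 = 0" "j2 = 0"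
    show ?thesis unfolding * init_prob_def L6V_def R_def using nz by (simp add: mult.assoc)
  next
    assume *: "i1 = 1" "j1 = 0" "i2 = 0" "j2 = 1"
    show ?thesis unfolding * init_prob_def L6V_def R_def using nz by (simp add: mult.assoc)
  next
    assume *: "i1 = 1" "j1 = 0" "i2 = 1" "j2 = 0"
    show ?thesis unfolding * init_prob_def L6V_def R_def using nz by (simp add: mult.assoc)
  next
    assume *: "i1 = 1" "j1 = 0" "i2 = 1" "j2 = 1"
    show ?thesis unfolding * init_prob_def L6V_def R_def using nz by (simp add: mult.assoc)
  next
    assume *: "i1 = 1" "j1 = 1" "i2 = 0" "j2 = 0"
    show ?thesis unfolding * init_prob_def L6V_def R_def using nz by (simp add: mult.assoc)
  next
    assume *: "i1 = 1" "j1 = 1" "i2 = 0" "j2 = 1"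
    show ?thesis unfolding * init_prob_def L6V_def R_def using nz by (simp add: mult.assoc)
  next
    assume *: "i1 = 1" "j1 = 1" "i2 = 1" "j2 = 0"
    show ?thesis unfolding * init_prob_def L6V_def R_def using nz by (simp add: mult.assoc)
  next
    assume *: "i1 = 1" "j1 = 1" "i2 = 1" "j2 = 1"
    show ?thesis unfolding * init_prob_def L6V_def R_def using nz by (simp add: mult.assoc)
  qed
qed

section \<open>Discrete random fields\<close>

text \<open>A multiset is coded by a chosen list of its elements. With countably many diagrams,
  conditioning on finitely many vertices splits the space into countably many events.\<close>

instance multiset :: (countable) countable
proof (rule countable_classI)
  fix A B :: "'a multiset"
  assume "to_nat (SOME xs. mset xs = A) = to_nat (SOME xs. mset xs = B)"
  then have "(SOME xs. mset xs = A) = (SOME xs. mset xs = B)" by simp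
  then show "A = B" by (metis (mono_tags) ex_mset someI_ex)
qed

lemma measurable_count_space_Pair:
  fixes f :: "'a \<Rightarrow> 'b :: countable" and g :: "'a \<Rightarrow> 'c :: countable"
  assumes "f \<in> measurable M (count_space UNIV)" "g \<in> measurable M (count_space UNIV)"
  shows "(\<lambda>\<omega>. (f \<omega>, g \<omega>)) \<in> measurable M (count_space UNIV)"
  using measurable_Pair[OF assms] by (simp add: pair_measure_countable)

lemma sets_fiber:
  assumes "finite T" "\<And>i. i \<in> T \<Longrightarrow> Z i \<in> measurable M (count_space UNIV)"
  shows "{\<omega> \<in> space M. \<forall>i\<in>T. Z i \<omega> = z i} \<in> sets M"
proof -
  have "{\<omega> \<in> space M. \<forall>i\<in>T. Z i \<omega> = z i} = space M \<inter> (\<Inter>i\<in>T. Z i -` {z i} \<inter> space M)"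
    by auto
  also have "\<dots> \<in> sets M"
  proof (cases "T = {}")
    case False
    then show ?thesis using assms
      by (intro sets.Int sets.top sets.finite_INT measurable_sets[of _ M "count_space UNIV"]) auto
  qed simp
  finally show ?thesis .
qed

text \<open>Countable additivity over the joint values of the finitely many \<open>Z i\<close>.
  Restriction to \<open>T\<close> lets \<open>P\<close> depend on these values alone and gives each
  fibre a unique label, so the fibres are disjoint.\<close>

lemma emeasure_fibers:
  fixes Z :: "'i \<Rightarrow> 'a \<Rightarrow> 'c :: countable"
  assumes T: "finite T" and Z: "\<And>i. i \<in> T \<Longrightarrow> Z i \<in> measurable M (count_space UNIV)"
    and B: "B \<in> sets M"
  shows "emeasure M {\<omega> \<in> B. P (\<lambda>i\<in>T. Z i \<omega>)} =
    (\<integral>\<^sup>+ z. emeasure M ({\<omega> \<in> space M. \<forall>i\<in>T. Z i \<omega> = z i} \<inter> B)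
      \<partial>count_space {z \<in> Pi\<^sub>E T (\<lambda>_. UNIV). P z})"
proof -
  let ?C = "{z \<in> Pi\<^sub>E T (\<lambda>_. UNIV). P z}"
  let ?E = "\<lambda>z. {\<omega> \<in> space M. \<forall>i\<in>T. Z i \<omega> = z i} \<inter> B"
  have C: "countable ?C"
    by (rule countable_subset[of _ "Pi\<^sub>E T (\<lambda>_. UNIV)"]) (auto intro!: countable_PiE T)
  have eq: "{\<omega> \<in> B. P (\<lambda>i\<in>T. Z i \<omega>)} = (\<Union>z\<in>?C. ?E z)"
  proof (intro equalityI subsetI)
    fix \<omega> assume "\<omega> \<in> {\<omega> \<in> B. P (\<lambda>i\<in>T. Z i \<omega>)}"
    then show "\<omega> \<in> (\<Union>z\<in>?C. ?E z)"
      using sets.sets_into_space[OF B] by (intro UN_I[of "\<lambda>i\<in>T. Z i \<omega>"]) auto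
  next
    fix \<omega> assume "\<omega> \<in> (\<Union>z\<in>?C. ?E z)"
    then obtain z where z: "z \<in> Pi\<^sub>E T (\<lambda>_. UNIV)" "P z" "\<forall>i\<in>T. Z i \<omega> = z i" "\<omega> \<in> B" by auto
    then have "(\<lambda>i\<in>T. Z i \<omega>) = z" by (auto simp: fun_eq_iff PiE_def extensional_def)
    with z show "\<omega> \<in> {\<omega> \<in> B. P (\<lambda>i\<in>T. Z i \<omega>)}" by auto
  qed
  have "disjoint_family_on ?E ?C"
    unfolding disjoint_family_on_def
  proof (intro ballI impI)
    fix z z' assume "z \<in> ?C" "z' \<in> ?C" "z \<noteq> z'"
    then obtain i where "i \<in> T" "z i \<noteq> z' i"
      using PiE_ext[of z T "\<lambda>_. UNIV" z'] by auto
    then show "?E z \<inter> ?E z' = {}" by auto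
  qed
  then show ?thesis
    unfolding eq using C B sets_fiber[OF T Z] by (intro emeasure_UN_countable) auto
qed

text \<open>There are countably many fibres, so the null ones have a null union. Combined with a
  sampling rule: at almost every outcome the probability of its own values is positive, so no factor
  of the corresponding product vanishes.\<close>

lemma AE_fiber_pos:
  fixes Z :: "'i \<Rightarrow> 'a \<Rightarrow> 'c :: countable"
  assumes M: "prob_space M"
    and T: "finite T" and Z: "\<And>i. i \<in> T \<Longrightarrow> Z i \<in> measurable M (count_space UNIV)"
  shows "AE \<omega> in M. 0 < measure M {\<omega>' \<in> space M. \<forall>i\<in>T. Z i \<omega>' = Z i \<omega>}"
proof -
  interpret prob_space M by (rule M)
  let ?E = "\<lambda>z. {\<omega> \<in> space M. \<forall>i\<in>T. Z i \<omega> = z i}"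
  have "AE \<omega> in M. \<forall>z\<in>Pi\<^sub>E T (\<lambda>_. UNIV). \<omega> \<in> ?E z \<longrightarrow> 0 < measure M (?E z)"
  proof (subst AE_ball_countable)
    show "countable (Pi\<^sub>E T (\<lambda>_. UNIV :: 'c set))" by (auto intro!: countable_PiE T)
    show "\<forall>z\<in>Pi\<^sub>E T (\<lambda>_. UNIV). AE \<omega> in M. \<omega> \<in> ?E z \<longrightarrow> 0 < measure M (?E z)"
    proof
      fix z
      show "AE \<omega> in M. \<omega> \<in> ?E z \<longrightarrow> 0 < measure M (?E z)"
      proof (cases "measure M (?E z) = 0")
        case True
        then have "?E z \<in> null_sets M"
          using sets_fiber[OF T Z] by (simp add: emeasure_eq_measure null_sets_def)
        from AE_not_in[OF this] show ?thesis by (rule AE_mp) (intro AE_I2; blast)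
      next
        case False
        then have "0 < measure M (?E z)" by (simp add: zero_less_measure_iff)
        then show ?thesis by simp
      qed
    qed
  qed
  then show ?thesis
  proof (rule AE_mp, intro AE_I2 impI)
    fix \<omega> assume \<omega>: "\<omega> \<in> space M"
      and *: "\<forall>z\<in>Pi\<^sub>E T (\<lambda>_. UNIV). \<omega> \<in> ?E z \<longrightarrow> 0 < measure M (?E z)"
    have "?E (\<lambda>i\<in>T. Z i \<omega>) = {\<omega>' \<in> space M. \<forall>i\<in>T. Z i \<omega>' = Z i \<omega>}" by auto
    with bspec[OF *, of "\<lambda>i\<in>T. Z i \<omega>"] \<omega> show "0 < measure M {\<omega>' \<in> space M. \<forall>i\<in>T. Z i \<omega>' = Z i \<omega>}"
      by auto
  qed
qed

text \<open>Lumping: if \<open>B\<close> has the same conditional probability \<open>K\<close> on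
  every fibre compatible with \<open>P\<close>, then also on their union. It replaces conditioning
  on diagrams by conditioning on lengths.\<close>

lemma measure_mult_fibers:
  fixes Z :: "'i \<Rightarrow> 'a \<Rightarrow> 'c :: countable"
  assumes M: "prob_space M"
    and T: "finite T" and Z: "\<And>i. i \<in> T \<Longrightarrow> Z i \<in> measurable M (count_space UNIV)"
    and B: "B \<in> sets M" and K: "0 \<le> K"
    and eq: "\<And>z. P z \<Longrightarrow> measure M ({\<omega> \<in> space M. \<forall>i\<in>T. Z i \<omega> = z i} \<inter> B) =
      measure M {\<omega> \<in> space M. \<forall>i\<in>T. Z i \<omega> = z i} * K"
  shows "measure M {\<omega> \<in> B. P (\<lambda>i\<in>T. Z i \<omega>)} = measure M {\<omega> \<in> space M. P (\<lambda>i\<in>T. Z i \<omega>)} * K"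
proof -
  interpret prob_space M by (rule M)
  let ?C = "{z \<in> Pi\<^sub>E T (\<lambda>_. UNIV). P z}"
  have "ennreal (measure M {\<omega> \<in> B. P (\<lambda>i\<in>T. Z i \<omega>)}) =
    (\<integral>\<^sup>+ z. ennreal (measure M ({\<omega> \<in> space M. \<forall>i\<in>T. Z i \<omega> = z i} \<inter> B)) \<partial>count_space ?C)"
    using emeasure_fibers[OF T Z B, where P = P] unfolding emeasure_eq_measure .
  also have "\<dots> = (\<integral>\<^sup>+ z. ennreal (measure M {\<omega> \<in> space M. \<forall>i\<in>T. Z i \<omega> = z i}) * ennreal K
      \<partial>count_space ?C)"
    using K by (intro nn_integral_cong) (simp add: eq ennreal_mult)
  also have "\<dots> = (\<integral>\<^sup>+ z. ennreal (measure M {\<omega> \<in> space M. \<forall>i\<in>T. Z i \<omega> = z i})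
      \<partial>count_space ?C) * ennreal K"
    by (rule nn_integral_multc) simp
  also have "(\<integral>\<^sup>+ z. ennreal (measure M {\<omega> \<in> space M. \<forall>i\<in>T. Z i \<omega> = z i}) \<partial>count_space ?C) =
      ennreal (measure M {\<omega> \<in> space M. P (\<lambda>i\<in>T. Z i \<omega>)})"
  proof -
    have "{\<omega> \<in> space M. \<forall>i\<in>T. Z i \<omega> = z i} \<inter> space M = {\<omega> \<in> space M. \<forall>i\<in>T. Z i \<omega> = z i}" for z
      by auto
    then show ?thesis
      using emeasure_fibers[OF T Z sets.top, where P = P] unfolding emeasure_eq_measure by simp
  qed
  finally have "ennreal (measure M {\<omega> \<in> B. P (\<lambda>i\<in>T. Z i \<omega>)}) =
      ennreal (measure M {\<omega> \<in> space M. P (\<lambda>i\<in>T. Z i \<omega>)} * K)"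
    using K by (simp only: ennreal_mult measure_nonneg)
  then show ?thesis
    using K by (simp only: ennreal_inj measure_nonneg mult_nonneg_nonneg)
qed

text \<open>A cylinder over \<open>J\<close> is a countable union of fibres over any finite
  \<open>T\<close> containing \<open>J\<close>, so point probabilities on a cofinal family of finite
  index sets determine the law. Below, these sets are the triangles \<open>corner d\<close>.\<close>

lemma distr_PiM_count_space_eqI:
  fixes F :: "'i \<Rightarrow> 'a \<Rightarrow> 'c :: countable" and G :: "'i \<Rightarrow> 'b \<Rightarrow> 'c"
  assumes M: "prob_space M" and N: "prob_space N"
    and F: "\<And>i. F i \<in> measurable M (count_space UNIV)"
    and G: "\<And>i. G i \<in> measurable N (count_space UNIV)"
    and cofinal: "\<And>J. finite J \<Longrightarrow> \<exists>T. finite T \<and> J \<subseteq> T \<and>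
      (\<forall>c. measure M {\<omega> \<in> space M. \<forall>i\<in>T. F i \<omega> = c i} = measure N {\<omega> \<in> space N. \<forall>i\<in>T. G i \<omega> = c i})"
  shows "distr M (PiM UNIV (\<lambda>_. count_space UNIV)) (\<lambda>\<omega> i. F i \<omega>) =
    distr N (PiM UNIV (\<lambda>_. count_space UNIV)) (\<lambda>\<omega> i. G i \<omega>)"
proof (rule measure_eqI_PiM_infinite)
  interpret M: prob_space M by (rule M)
  interpret N: prob_space N by (rule N)
  have FM: "(\<lambda>\<omega> i. F i \<omega>) \<in> measurable M (PiM UNIV (\<lambda>_. count_space UNIV))"
    by (rule measurable_PiM_single') (use F in auto)
  have GM: "(\<lambda>\<omega> i. G i \<omega>) \<in> measurable N (PiM UNIV (\<lambda>_. count_space UNIV))"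
    by (rule measurable_PiM_single') (use G in auto)
  show "finite_measure (distr M (PiM UNIV (\<lambda>_. count_space UNIV)) (\<lambda>\<omega> i. F i \<omega>))"
    using FM by (rule M.finite_measure_distr)
  fix A :: "'i \<Rightarrow> 'c set" and J :: "'i set"
  assume J: "finite J"
  obtain T where T: "finite T" "J \<subseteq> T"
    and eq: "\<And>c. measure M {\<omega> \<in> space M. \<forall>i\<in>T. F i \<omega> = c i} =
      measure N {\<omega> \<in> space N. \<forall>i\<in>T. G i \<omega> = c i}"
    using cofinal[OF J] by blast
  let ?X = "prod_emb UNIV (\<lambda>_. count_space UNIV) J (Pi\<^sub>E J A)"
  let ?P = "\<lambda>z. \<forall>i\<in>J. z i \<in> A i"
  have X: "?X \<in> sets (PiM UNIV (\<lambda>_. count_space UNIV))"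
    using J by (intro sets_PiM_I) auto
  have fm: "{\<omega> \<in> space M. \<forall>i\<in>T. F i \<omega> = z i} \<inter> space M = {\<omega> \<in> space M. \<forall>i\<in>T. F i \<omega> = z i}"
    "{\<omega> \<in> space N. \<forall>i\<in>T. G i \<omega> = z i} \<inter> space N = {\<omega> \<in> space N. \<forall>i\<in>T. G i \<omega> = z i}" for z
    by auto
  have pre: "(\<lambda>\<omega> i. F i \<omega>) -` ?X \<inter> space M = {\<omega> \<in> space M. ?P (\<lambda>i\<in>T. F i \<omega>)}"
    "(\<lambda>\<omega> i. G i \<omega>) -` ?X \<inter> space N = {\<omega> \<in> space N. ?P (\<lambda>i\<in>T. G i \<omega>)}"
    using T(2) by (auto simp: prod_emb_def PiE_iff subset_iff)
  have "emeasure M {\<omega> \<in> space M. ?P (\<lambda>i\<in>T. F i \<omega>)} = emeasure N {\<omega> \<in> space N. ?P (\<lambda>i\<in>T. G i \<omega>)}"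
    by (subst (1 2) emeasure_fibers[where P = ?P, OF T(1) _ sets.top])
      (use F G in \<open>simp_all only: fm M.emeasure_eq_measure N.emeasure_eq_measure eq\<close>)
  then show "emeasure (distr M (PiM UNIV (\<lambda>_. count_space UNIV)) (\<lambda>\<omega> i. F i \<omega>)) ?X =
      emeasure (distr N (PiM UNIV (\<lambda>_. count_space UNIV)) (\<lambda>\<omega> i. G i \<omega>)) ?X"
    unfolding emeasure_distr[OF FM X] emeasure_distr[OF GM X] pre .
qed simp_all

section \<open>The height function of the six vertex model\<close>

lemma L6V_nonneg:
  assumes "0 < q" "q < 1" "0 \<le> z" "z < 1"
  shows "0 \<le> L6V q z i1 j1 i2 j2"
proof -
  have "q * z < 1" using assms by (intro mult_less_one) auto
  then show ?thesis using assms unfolding L6V_def by auto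
qed

lemma L6V_conserve:
  assumes "L6V q z i1 j1 i2 j2 \<noteq> 0"
  shows "i1 + j1 = i2 + j2"
  using assms unfolding L6V_def by (auto split: if_splits)

section \<open>Triangles and height profiles\<close>

definition layer :: "nat \<Rightarrow> (nat \<times> nat) set" where
  "layer d = {(x, y). 1 \<le> x \<and> 1 \<le> y \<and> x + y = d + 1}"

lemma finite_layer: "finite (layer d)"
  by (rule finite_subset[of _ "{..d + 1} \<times> {..d + 1}"]) (auto simp: layer_def)

definition corner :: "nat \<Rightarrow> (nat \<times> nat) set" where
  "corner d = {(x, y). x + y \<le> d}"

lemma finite_corner: "finite (corner d)"
  by (rule finite_subset[of _ "{..d} \<times> {..d}"]) (auto simp: corner_def)

lemma ball_corner: "(\<forall>i\<in>corner d. P i) \<longleftrightarrow> (\<forall>x y. x + y \<le> d \<longrightarrow> P (x, y))"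
  unfolding corner_def by auto

text \<open>The height profiles of path configurations with step boundary conditions:
  \<open>c 0 y = int y\<close> counts the paths entering the first \<open>y\<close> rows. Profiles
  are integer-valued because y - l may be negative on a null set of the Yang-Baxter field.\<close>

definition admissible :: "nat \<Rightarrow> (nat \<Rightarrow> nat \<Rightarrow> int) \<Rightarrow> bool" where
  "admissible d c \<longleftrightarrow>
     (\<forall>x\<le>d. c x 0 = 0) \<and> (\<forall>y\<le>d. c 0 y = int y) \<and>
     (\<forall>x\<ge>1. \<forall>y\<ge>1. x + y \<le> d \<longrightarrow>
        c (x - 1) y - c x y \<in> {0, 1} \<and> c x y - c x (y - 1) \<in> {0, 1})"

text \<open>The numbers of paths on the edges leaving \<open>(x, y)\<close> upwards and to the right, where \<open>c x y\<close>
  is the height at \<open>(x + 1, y)\<close>.\<close>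

definition vert :: "(nat \<Rightarrow> nat \<Rightarrow> int) \<Rightarrow> nat \<Rightarrow> nat \<Rightarrow> nat" where
  "vert c x y = nat (c (x - 1) y - c x y)"

definition horiz :: "(nat \<Rightarrow> nat \<Rightarrow> int) \<Rightarrow> nat \<Rightarrow> nat \<Rightarrow> nat" where
  "horiz c x y = nat (c x y - c x (y - 1))"

lemma admissible_mono: "admissible d c \<Longrightarrow> d' \<le> d \<Longrightarrow> admissible d' c"
  unfolding admissible_def by auto

lemma admissible_vert:
  assumes "admissible d c" "1 \<le> x" "x + y \<le> d"
  shows "int (vert c x y) = c (x - 1) y - c x y" "vert c x y \<le> 1"
proof -
  have "c (x - 1) y - c x y \<in> {0, 1}"
    using assms unfolding admissible_def by (cases "y = 0") auto
  then show "int (vert c x y) = c (x - 1) y - c x y" "vert c x y \<le> 1"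
    unfolding vert_def by auto
qed

lemma admissible_horiz:
  assumes "admissible d c" "1 \<le> y" "x + y \<le> d"
  shows "int (horiz c x y) = c x y - c x (y - 1)" "horiz c x y \<le> 1"
proof -
  have "c x y - c x (y - 1) \<in> {0, 1}"
    using assms unfolding admissible_def by (cases "x = 0") auto
  then show "int (horiz c x y) = c x y - c x (y - 1)" "horiz c x y \<le> 1"
    unfolding horiz_def by auto
qed

lemma admissible_cong:
  assumes "\<And>x y. x + y \<le> d \<Longrightarrow> c x y = c' x y" "admissible d c"
  shows "admissible d c'"
proof -
  have "c (x - 1) y = c' (x - 1) y" "c x y = c' x y" "c x (y - 1) = c' x (y - 1)"
    if "x + y \<le> d" for x y
    using that by (auto intro!: assms(1))
  moreover have "c x 0 = c' x 0" "c 0 x = c' 0 x" if "x \<le> d" for x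
    using that by (auto intro!: assms(1))
  ultimately show ?thesis using assms(2) unfolding admissible_def by auto
qed

text \<open>The sequential sampling rule of the six vertex model in terms of heights alone.\<close>

definition height_law ::
    "real \<Rightarrow> (nat \<Rightarrow> real) \<Rightarrow> (nat \<Rightarrow> real) \<Rightarrow> 'w measure \<Rightarrow> (nat \<Rightarrow> nat \<Rightarrow> 'w \<Rightarrow> int) \<Rightarrow> bool" where
  "height_law q u v M F \<longleftrightarrow>
     prob_space M \<and> (\<forall>x y. F x y \<in> measurable M (count_space UNIV)) \<and>
     (\<forall>\<omega>\<in>space M. F 0 0 \<omega> = 0) \<and>
     (\<forall>d c. measure M {\<omega> \<in> space M. \<forall>x y. x + y \<le> d + 1 \<longrightarrow> F x y \<omega> = c x y} =
        (if admissible (d + 1) c then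
           measure M {\<omega> \<in> space M. \<forall>x y. x + y \<le> d \<longrightarrow> F x y \<omega> = c x y} *
           (\<Prod>(x, y)\<in>layer d. L6V q (u y * v x)
              (vert c x (y - 1)) (horiz c (x - 1) y) (vert c x y) (horiz c x y))
         else 0))"

text \<open>At d = 0 the only vertex is the origin, of height 0; the recursion then determines all
  point probabilities on \<open>corner d\<close>, and every finite set of vertices lies in such a
  triangle.\<close>

lemma height_law_unique:
  assumes F: "height_law q u v M F" and G: "height_law q u v N G"
  shows "distr M (PiM UNIV (\<lambda>_. count_space UNIV)) (\<lambda>\<omega> (x, y). F x y \<omega>) =
    distr N (PiM UNIV (\<lambda>_. count_space UNIV)) (\<lambda>\<omega> (x, y). G x y \<omega>)"
proof -
  have M: "prob_space M" and N: "prob_space N" using F G unfolding height_law_def by auto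
  have fdd: "measure M {\<omega> \<in> space M. \<forall>x y. x + y \<le> d \<longrightarrow> F x y \<omega> = c x y} =
      measure N {\<omega> \<in> space N. \<forall>x y. x + y \<le> d \<longrightarrow> G x y \<omega> = c x y}" for d c
  proof (induction d)
    case 0
    have "{\<omega> \<in> space M. \<forall>x y. x + y \<le> 0 \<longrightarrow> F x y \<omega> = c x y} = (if c 0 0 = 0 then space M else {})"
      using F unfolding height_law_def by auto
    moreover have "{\<omega> \<in> space N. \<forall>x y. x + y \<le> 0 \<longrightarrow> G x y \<omega> = c x y} = (if c 0 0 = 0 then space N else {})"
      using G unfolding height_law_def by auto
    ultimately show ?case
      using prob_space.prob_space[OF M] prob_space.prob_space[OF N] by simp
  next
    case (Suc d)
    then show ?case
      using F G unfolding height_law_def Suc_eq_plus1 by simp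
  qed
  have "distr M (PiM UNIV (\<lambda>_. count_space UNIV)) (\<lambda>\<omega> i. F (fst i) (snd i) \<omega>) =
    distr N (PiM UNIV (\<lambda>_. count_space UNIV)) (\<lambda>\<omega> i. G (fst i) (snd i) \<omega>)"
  proof (rule distr_PiM_count_space_eqI[OF M N])
    fix J :: "(nat \<times> nat) set" assume "finite J"
    then have "finite ((\<lambda>(x, y). x + y) ` J)" by simp
    then obtain d where "\<forall>n\<in>(\<lambda>(x, y). x + y) ` J. n \<le> d" using finite_nat_set_iff_bounded_le by auto
    then have "J \<subseteq> corner d" unfolding corner_def by auto
    moreover have "measure M {\<omega> \<in> space M. \<forall>i\<in>corner d. F (fst i) (snd i) \<omega> = c i} =
      measure N {\<omega> \<in> space N. \<forall>i\<in>corner d. G (fst i) (snd i) \<omega> = c i}" for c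
      using fdd[of d "\<lambda>x y. c (x, y)"] by (simp add: ball_corner)
    ultimately show "\<exists>T. finite T \<and> J \<subseteq> T \<and>
      (\<forall>c. measure M {\<omega> \<in> space M. \<forall>i\<in>T. F (fst i) (snd i) \<omega> = c i} =
        measure N {\<omega> \<in> space N. \<forall>i\<in>T. G (fst i) (snd i) \<omega> = c i})"
      using finite_corner by blast
  qed (use F G in \<open>auto simp: height_law_def\<close>)
  then show ?thesis by (simp add: case_prod_unfold)
qed

section \<open>Heights and path conservation\<close>

lemma height6V_vert:
  assumes V0: "\<And>x. 1 \<le> x \<Longrightarrow> V x 0 \<omega> = 0" and W0: "\<And>y. 1 \<le> y \<Longrightarrow> W 0 y \<omega> = 1"
    and W1: "\<And>x y. 1 \<le> y \<Longrightarrow> W x y \<omega> \<le> 1"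
    and cons: "\<And>x y. 1 \<le> x \<Longrightarrow> 1 \<le> y \<Longrightarrow> V x (y - 1) \<omega> + W (x - 1) y \<omega> = V x y \<omega> + W x y \<omega>"
  shows "height6V W (x + 1) 0 \<omega> = 0"
    and "height6V W (x + 1) (Suc y) \<omega> = height6V W (x + 1) y \<omega> + W x (Suc y) \<omega>"
    and "height6V W 1 y \<omega> = y"
    and "1 \<le> x \<Longrightarrow> height6V W x y \<omega> = height6V W (x + 1) y \<omega> + V x y \<omega>"
proof -
  show h0: "height6V W (x + 1) 0 \<omega> = 0" for x by (simp add: height6V_def)
  show hS: "height6V W (x + 1) (Suc y) \<omega> = height6V W (x + 1) y \<omega> + W x (Suc y) \<omega>" for x y
  proof -
    have "{k \<in> {1..Suc y}. W x k \<omega> = 1} =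
        (if W x (Suc y) \<omega> = 1 then insert (Suc y) {k \<in> {1..y}. W x k \<omega> = 1} else {k \<in> {1..y}. W x k \<omega> = 1})"
      by (auto simp: le_Suc_eq)
    moreover have "W x (Suc y) \<omega> = 0 \<or> W x (Suc y) \<omega> = 1" using W1[of "Suc y" x] by auto
    ultimately show ?thesis unfolding height6V_def by auto
  qed
  show "height6V W 1 y \<omega> = y" using h0[of 0] hS[of 0] W0 by (induction y) auto
  \<comment> \<open>Paths entering column \<open>x\<close> from the left at levels up to
    \<open>y\<close> either leave it to the right or stand on its vertical edge at level
    \<open>y\<close>, as none enters from below. Conservation at \<open>(x, Suc y)\<close> is the
    induction step.\<close>
  show "height6V W x y \<omega> = height6V W (x + 1) y \<omega> + V x y \<omega>" if "1 \<le> x"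
  proof (induction y)
    case 0
    then show ?case using h0[of "x - 1"] h0[of x] V0 that by simp
  next
    case (Suc y)
    then show ?case using hS[of "x - 1" y] hS[of x y] cons[of x "Suc y"] that by simp
  qed
qed

lemma six_vertex_sampling:
  assumes "six_vertex q u v N V W"
  shows "measure N {\<omega> \<in> space N.
            (\<forall>x\<ge>1. \<forall>y. x + y \<le> d + 1 \<longrightarrow> V x y \<omega> = \<sigma> x y) \<and>
            (\<forall>x. \<forall>y\<ge>1. x + y \<le> d + 1 \<longrightarrow> W x y \<omega> = \<tau> x y)} =
        measure N {\<omega> \<in> space N.
            (\<forall>x\<ge>1. \<forall>y. x + y \<le> d \<longrightarrow> V x y \<omega> = \<sigma> x y) \<and>
            (\<forall>x. \<forall>y\<ge>1. x + y \<le> d \<longrightarrow> W x y \<omega> = \<tau> x y)} *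
        (if \<sigma> (d + 1) 0 = 0 \<and> \<tau> 0 (d + 1) = 1 then 1 else 0) *
        (\<Prod>(x, y) \<in> layer d. L6V q (u y * v x) (\<sigma> x (y - 1)) (\<tau> (x - 1) y) (\<sigma> x y) (\<tau> x y))"
  using assms unfolding six_vertex_def layer_def by blast

text \<open>Conservation is not imposed pathwise; it holds almost surely because \<open>L6V\<close>
  vanishes otherwise, so an outcome whose fibre has positive probability conserves paths.\<close>

lemma six_vertex_AE_conserve:
  assumes "six_vertex q u v N V W"
  shows "AE \<omega> in N. \<forall>x\<ge>1. \<forall>y\<ge>1. V x (y - 1) \<omega> + W (x - 1) y \<omega> = V x y \<omega> + W x y \<omega>"
proof -
  have N: "prob_space N"
    and mV: "\<And>x y. 1 \<le> x \<Longrightarrow> V x y \<in> measurable N (count_space UNIV)"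
    and mW: "\<And>x y. 1 \<le> y \<Longrightarrow> W x y \<in> measurable N (count_space UNIV)"
    using assms unfolding six_vertex_def by blast+
  note rule = six_vertex_sampling[OF assms]
  \<comment> \<open>Only \<open>V x y\<close> with \<open>1 <= x\<close> and \<open>W x y\<close>
    with \<open>1 <= y\<close> are known to be measurable; the constant 0 replaces the
    others.\<close>
  define Z where "Z = (\<lambda>(x, y) \<omega>. (if 1 \<le> x then V x y \<omega> else 0, if 1 \<le> y then W x y \<omega> else 0))"
  have "(\<lambda>\<omega>. if 1 \<le> x then V x y \<omega> else 0) \<in> measurable N (count_space UNIV)"
    and "(\<lambda>\<omega>. if 1 \<le> y then W x y \<omega> else 0) \<in> measurable N (count_space UNIV)" for x y :: nat
    using mV[of x y] mW[of y x] by (cases "1 \<le> x"; cases "1 \<le> y"; simp)+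
  then have mZ: "Z i \<in> measurable N (count_space UNIV)" for i
    unfolding Z_def by (cases i) (simp only: prod.case measurable_count_space_Pair)
  have "AE \<omega> in N. \<forall>(x, y)\<in>layer d. V x (y - 1) \<omega> + W (x - 1) y \<omega> = V x y \<omega> + W x y \<omega>" for d
    using AE_fiber_pos[OF N finite_corner mZ, of "d + 1"]
  proof (rule AE_mp, intro AE_I2 impI)
    fix \<omega> assume pos: "0 < measure N {\<omega>' \<in> space N. \<forall>i\<in>corner (d + 1). Z i \<omega>' = Z i \<omega>}"
    have "{\<omega>' \<in> space N. \<forall>i\<in>corner (d + 1). Z i \<omega>' = Z i \<omega>} = {\<omega>' \<in> space N.
            (\<forall>x\<ge>1. \<forall>y. x + y \<le> d + 1 \<longrightarrow> V x y \<omega>' = V x y \<omega>) \<and>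
            (\<forall>x. \<forall>y\<ge>1. x + y \<le> d + 1 \<longrightarrow> W x y \<omega>' = W x y \<omega>)}"
      by (auto simp: Z_def corner_def)
    with pos rule[of d "\<lambda>x y. V x y \<omega>" "\<lambda>x y. W x y \<omega>"]
    have "(\<Prod>(x, y) \<in> layer d. L6V q (u y * v x) (V x (y - 1) \<omega>) (W (x - 1) y \<omega>) (V x y \<omega>) (W x y \<omega>)) \<noteq> 0"
      by (intro notI) simp
    then show "\<forall>(x, y)\<in>layer d. V x (y - 1) \<omega> + W (x - 1) y \<omega> = V x y \<omega> + W x y \<omega>"
      using finite_layer[of d] by (auto dest!: L6V_conserve)
  qed
  then have "AE \<omega> in N. \<forall>d. \<forall>(x, y)\<in>layer d. V x (y - 1) \<omega> + W (x - 1) y \<omega> = V x y \<omega> + W x y \<omega>"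
    by (subst AE_all_countable) blast
  then show ?thesis
  proof (rule AE_mp, intro AE_I2 impI allI)
    fix \<omega> and x y :: nat
    assume *: "\<forall>d. \<forall>(x, y)\<in>layer d. V x (y - 1) \<omega> + W (x - 1) y \<omega> = V x y \<omega> + W x y \<omega>"
      and "1 \<le> x" "1 \<le> y"
    then have "(x, y) \<in> layer (x + y - 1)" unfolding layer_def by auto
    with * show "V x (y - 1) \<omega> + W (x - 1) y \<omega> = V x y \<omega> + W x y \<omega>" by blast
  qed
qed


text \<open>Off a null set, the heights and the edge occupations on a triangle determine each other,
  so the rule for edges transfers to heights.\<close>

lemma six_vertex_height_law:
  assumes sv: "six_vertex q u v N V W"
  shows "height_law q u v N (\<lambda>x y \<omega>. int (height6V W (x + 1) y \<omega>))"
proof -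
  have N: "prob_space N"
    and mV: "\<And>x y. 1 \<le> x \<Longrightarrow> V x y \<in> measurable N (count_space UNIV)"
    and mW: "\<And>x y. 1 \<le> y \<Longrightarrow> W x y \<in> measurable N (count_space UNIV)"
    and bd: "\<And>\<omega> x. \<omega> \<in> space N \<Longrightarrow> 1 \<le> x \<Longrightarrow> V x 0 \<omega> = 0" "\<And>\<omega> y. \<omega> \<in> space N \<Longrightarrow> 1 \<le> y \<Longrightarrow> W 0 y \<omega> = 1"
    and le1: "\<And>\<omega> x y. \<omega> \<in> space N \<Longrightarrow> 1 \<le> x \<Longrightarrow> V x y \<omega> \<le> 1"
      "\<And>\<omega> x y. \<omega> \<in> space N \<Longrightarrow> 1 \<le> y \<Longrightarrow> W x y \<omega> \<le> 1"
    using sv unfolding six_vertex_def by blast+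
  note rule = six_vertex_sampling[OF sv]
  define G where "G x y \<omega> = int (height6V W (x + 1) y \<omega>)" for x y \<omega>
  have mG: "G x y \<in> measurable N (count_space UNIV)" for x y
  proof -
    have "(\<lambda>\<omega>. card {k \<in> {1..y}. W x k \<omega> = 1}) \<in> measurable N (count_space UNIV)"
    proof (rule measurable_card)
      fix k
      show "{\<omega> \<in> space N. k \<in> {k \<in> {1..y}. W x k \<omega> = 1}} \<in> sets N"
      proof (cases "k \<in> {1..y}")
        case True
        then have "{\<omega> \<in> space N. k \<in> {k \<in> {1..y}. W x k \<omega> = 1}} = W x k -` {1} \<inter> space N" by blast
        also have "\<dots> \<in> sets N" using True by (intro measurable_sets[OF mW]) simp_all
        finally show ?thesis .
      next
        case False
        then have "{\<omega> \<in> space N. k \<in> {k \<in> {1..y}. W x k \<omega> = 1}} = {}" by blast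
        then show ?thesis by (simp only: sets.empty_sets)
      qed
    qed
    then have "(\<lambda>\<omega>. int (card {k \<in> {1..y}. W x k \<omega> = 1})) \<in> measurable N (count_space UNIV)"
      by (rule measurable_compose[of _ _ _ int]) simp
    moreover have "G x y = (\<lambda>\<omega>. int (card {k \<in> {1..y}. W x k \<omega> = 1}))"
      by (simp add: fun_eq_iff G_def height6V_def)
    ultimately show ?thesis by (simp only:)
  qed
  define good where "good \<omega> \<longleftrightarrow> (\<forall>x y.
    G x 0 \<omega> = 0 \<and> G 0 y \<omega> = int y \<and> (1 \<le> y \<longrightarrow> G x y \<omega> - G x (y - 1) \<omega> = int (W x y \<omega>)) \<and>
    (1 \<le> x \<longrightarrow> G (x - 1) y \<omega> - G x y \<omega> = int (V x y \<omega>)))" for \<omega>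
  have goodD: "G x 0 \<omega> = 0" "G 0 y \<omega> = int y"
    "1 \<le> y \<Longrightarrow> G x y \<omega> - G x (y - 1) \<omega> = int (W x y \<omega>)"
    "1 \<le> x \<Longrightarrow> G (x - 1) y \<omega> - G x y \<omega> = int (V x y \<omega>)" if "good \<omega>" for \<omega> x y
    using that[unfolded good_def, THEN spec, THEN spec, of x y] by blast+
  have AE_good: "AE \<omega> in N. good \<omega>"
    using six_vertex_AE_conserve[OF sv]
  proof (rule AE_mp, intro AE_I2 impI)
    fix \<omega> assume \<omega>: "\<omega> \<in> space N"
      and c: "\<forall>x\<ge>1. \<forall>y\<ge>1. V x (y - 1) \<omega> + W (x - 1) y \<omega> = V x y \<omega> + W x y \<omega>"
    have c': "1 \<le> x \<Longrightarrow> 1 \<le> y \<Longrightarrow> V x (y - 1) \<omega> + W (x - 1) y \<omega> = V x y \<omega> + W x y \<omega>" for x y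
      using c by blast
    note hyps = bd[OF \<omega>] le1(2)[OF \<omega>] c'
    have h0: "height6V W (x + 1) 0 \<omega> = 0" for x
      by (rule height6V_vert(1)[where V = V and W = W and \<omega> = \<omega>, OF hyps])
    have hS: "height6V W (x + 1) (Suc y) \<omega> = height6V W (x + 1) y \<omega> + W x (Suc y) \<omega>" for x y
      by (rule height6V_vert(2)[where V = V and W = W and \<omega> = \<omega>, OF hyps])
    have h1: "height6V W 1 y \<omega> = y" for y
      by (rule height6V_vert(3)[where V = V and W = W and \<omega> = \<omega>, OF hyps])
    have hV: "height6V W x y \<omega> = height6V W (x + 1) y \<omega> + V x y \<omega>" if "1 \<le> x" for x y
      by (rule height6V_vert(4)[where V = V and W = W and \<omega> = \<omega>, OF hyps that])
    show "good \<omega>"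
      unfolding good_def
    proof (intro allI conjI impI)
      fix x y
      show "G x 0 \<omega> = 0" unfolding G_def using h0 by simp
      show "G 0 y \<omega> = int y" unfolding G_def using h1 by simp
      show "G x y \<omega> - G x (y - 1) \<omega> = int (W x y \<omega>)" if "1 \<le> y"
        unfolding G_def using hS[of x "y - 1"] that by simp
      show "G (x - 1) y \<omega> - G x y \<omega> = int (V x y \<omega>)" if "1 \<le> x"
        unfolding G_def using hV[of x y] that by simp
    qed
  qed
  have good_admissible: "admissible d (\<lambda>x y. G x y \<omega>)" if "good \<omega>" "\<omega> \<in> space N" for \<omega> d
    unfolding admissible_def
  proof (intro conjI allI impI)
    fix x y :: nat assume xy: "1 \<le> x" "1 \<le> y"
    show "G (x - 1) y \<omega> - G x y \<omega> \<in> {0, 1}"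
      using le1(1)[OF that(2) xy(1), of y] unfolding goodD(4)[OF that(1) xy(1)] by auto
    show "G x y \<omega> - G x (y - 1) \<omega> \<in> {0, 1}"
      using le1(2)[OF that(2) xy(2), of x] unfolding goodD(3)[OF that(1) xy(2)] by auto
  qed (use goodD(1,2)[OF that(1)] in auto)
  define A where "A d c = {\<omega> \<in> space N. \<forall>x y. x + y \<le> d \<longrightarrow> G x y \<omega> = c x y}" for d c
  define E where "E d \<sigma> \<tau> = {\<omega> \<in> space N. (\<forall>x\<ge>1. \<forall>y. x + y \<le> d \<longrightarrow> V x y \<omega> = \<sigma> x y) \<and>
    (\<forall>x. \<forall>y\<ge>1. x + y \<le> d \<longrightarrow> W x y \<omega> = \<tau> x y)}" for d and \<sigma> \<tau> :: "nat \<Rightarrow> nat \<Rightarrow> nat"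
  have [measurable]: "A d c \<in> sets N" for d c
    using sets_fiber[of "corner d" "\<lambda>i. G (fst i) (snd i)" N "\<lambda>i. c (fst i) (snd i)"] mG finite_corner[of d]
    unfolding A_def by (simp add: ball_corner)
  have E_sets: "E d \<sigma> \<tau> \<in> sets N" for d \<sigma> \<tau>
  proof -
    have "E d \<sigma> \<tau> = {\<omega> \<in> space N. \<forall>i\<in>{i \<in> corner d. 1 \<le> fst i}. V (fst i) (snd i) \<omega> = \<sigma> (fst i) (snd i)} \<inter>
      {\<omega> \<in> space N. \<forall>i\<in>{i \<in> corner d. 1 \<le> snd i}. W (fst i) (snd i) \<omega> = \<tau> (fst i) (snd i)}"
      unfolding E_def corner_def by auto
    also have "\<dots> \<in> sets N"
      using mV mW finite_corner[of d] by (intro sets.Int sets_fiber) auto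
    finally show ?thesis .
  qed
  have A_E: "measure N (A d c) = measure N (E d (vert c) (horiz c))" if adm: "admissible d c" for d c
  proof (rule measure_eq_AE)
    show "AE \<omega> in N. \<omega> \<in> A d c \<longleftrightarrow> \<omega> \<in> E d (vert c) (horiz c)"
      using AE_good
    proof (rule AE_mp, intro AE_I2 impI iffI)
      fix \<omega> assume \<omega>: "\<omega> \<in> space N" "good \<omega>" "\<omega> \<in> A d c"
      have G: "G x y \<omega> = c x y" if "x + y \<le> d" for x y
        using \<omega>(3) that unfolding A_def by blast
      have "V x y \<omega> = vert c x y" if "1 \<le> x" "x + y \<le> d" for x y
        using G[of "x - 1" y] G[of x y] goodD(4)[OF \<omega>(2), of x y] that unfolding vert_def by simp
      moreover have "W x y \<omega> = horiz c x y" if "1 \<le> y" "x + y \<le> d" for x y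
        using G[of x "y - 1"] G[of x y] goodD(3)[OF \<omega>(2), of y x] that unfolding horiz_def by simp
      ultimately show "\<omega> \<in> E d (vert c) (horiz c)" using \<omega>(1) unfolding E_def by simp
    next
      fix \<omega> assume \<omega>: "\<omega> \<in> space N" "good \<omega>" "\<omega> \<in> E d (vert c) (horiz c)"
      \<comment> \<open>In each column the heights are recovered by adding horizontal edges upwards
        from the boundary value 0.\<close>
      have "G x y \<omega> = c x y" if "x + y \<le> d" for x y
        using that
      proof (induction y)
        case 0
        then show ?case using goodD(1)[OF \<omega>(2)] adm unfolding admissible_def by simp
      next
        case (Suc y)
        then have "W x (Suc y) \<omega> = horiz c x (Suc y)" using \<omega>(3) unfolding E_def by simp
        moreover have "G x (Suc y) \<omega> - G x y \<omega> = int (W x (Suc y) \<omega>)"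
          using goodD(3)[OF \<omega>(2), of "Suc y" x] by simp
        ultimately show ?case using Suc admissible_horiz(1)[OF adm, of "Suc y" x] by simp
      qed
      then show "\<omega> \<in> A d c" using \<omega>(1) unfolding A_def by simp
    qed
  qed (use E_sets in auto)
  have A_null: "measure N (A d c) = 0" if "\<not> admissible d c" for d c
  proof -
    have "measure N (A d c) = measure N {}"
    proof (rule measure_eq_AE)
      show "AE \<omega> in N. \<omega> \<in> A d c \<longleftrightarrow> \<omega> \<in> {}"
        using AE_good
      proof (rule AE_mp, intro AE_I2 impI)
        fix \<omega> assume "\<omega> \<in> space N" "good \<omega>"
        then have "admissible d (\<lambda>x y. G x y \<omega>)" by (rule good_admissible[rotated])
        then have "\<omega> \<notin> A d c" using that admissible_cong[of d "\<lambda>x y. G x y \<omega>" c] unfolding A_def by blast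
        then show "\<omega> \<in> A d c \<longleftrightarrow> \<omega> \<in> {}" by simp
      qed
    qed auto
    then show ?thesis by simp
  qed
  have "measure N (A (d + 1) c) = (if admissible (d + 1) c then measure N (A d c) *
      (\<Prod>(x, y)\<in>layer d. L6V q (u y * v x)
        (vert c x (y - 1)) (horiz c (x - 1) y) (vert c x y) (horiz c x y)) else 0)" for d c
  proof (cases "admissible (d + 1) c")
    case True
    \<comment> \<open>An admissible profile prescribes the step boundary values on the new boundary
      edges, so the boundary factor of the rule is 1.\<close>
    then have "vert c (d + 1) 0 = 0" "horiz c 0 (d + 1) = 1"
      unfolding admissible_def vert_def horiz_def by auto
    with True A_E[OF True] A_E[OF admissible_mono[OF True, of d]] rule[of d "vert c" "horiz c"]
    show ?thesis unfolding E_def by simp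
  qed (simp add: A_null)
  moreover have "G 0 0 \<omega> = 0" for \<omega> unfolding G_def height6V_def by simp
  ultimately show ?thesis
    unfolding height_law_def G_def[symmetric] A_def[symmetric] using N mG by blast
qed

section \<open>The lengths in the Yang--Baxter field\<close>

text \<open>Deterministic: it concerns one outcome at which all forward probabilities are nonzero.
  Induction on x + y propagates the strips in both directions from the empty diagrams on the
  axes.\<close>

lemma field_strips:
  fixes Lam :: "nat \<Rightarrow> nat \<Rightarrow> diagram" and j j' :: "nat \<Rightarrow> nat \<Rightarrow> nat \<Rightarrow> nat"
  assumes par: "0 < q" "q < 1" "- 1 < s" "s < 0"
    and u: "\<And>y. 1 \<le> y \<Longrightarrow> 0 \<le> u y \<and> u y < 1"
    and v: "\<And>x. 1 \<le> x \<Longrightarrow> 0 \<le> v x \<and> v x < 1"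
    and Q: "\<And>x y. 1 \<le> x \<Longrightarrow> 1 \<le> y \<Longrightarrow> bijectivization q s (u y) (v x) Q"
    and zero: "\<And>x y. 0 \<notin># Lam x y"
    and empty: "\<And>x. Lam x 0 = {#}" "\<And>y. Lam 0 y = {#}"
    and fin: "\<And>x y. 1 \<le> x \<Longrightarrow> 1 \<le> y \<Longrightarrow> \<exists>H. \<forall>h\<ge>H. j x y h = 0 \<and> j' x y h = 0"
    and fp: "\<And>x y H. 1 \<le> x \<Longrightarrow> 1 \<le> y \<Longrightarrow>
      forward_prob q Q (u y) (v x) (Lam (x - 1) (y - 1)) (Lam x (y - 1)) (Lam (x - 1) y) H
        (count (Lam x y)) (j x y) (j' x y) \<noteq> 0"
  shows "1 \<le> x \<Longrightarrow> 1 \<le> y \<Longrightarrow> size (Lam x y) = size (Lam x (y - 1)) + j x y 0 \<and>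
    size (Lam x y) = size (Lam (x - 1) y) + j' x y 0 \<and> j x y 0 \<le> 1 \<and> j' x y 0 \<le> 1"
proof -
  have step: "strip q s (v x) (Lam (x - 1) y) (Lam x y) \<and> strip q s (u y) (Lam x (y - 1)) (Lam x y) \<and>
      size (Lam x y) = size (Lam x (y - 1)) + j x y 0 \<and>
      size (Lam x y) = size (Lam (x - 1) y) + j' x y 0 \<and> j x y 0 \<le> 1 \<and> j' x y 0 \<le> 1"
    if xy: "1 \<le> x" "1 \<le> y"
      and strips: "strip q s (v x) (Lam (x - 1) (y - 1)) (Lam x (y - 1))"
        "strip q s (u y) (Lam (x - 1) (y - 1)) (Lam (x - 1) y)" for x y
  proof -
    have uv: "0 \<le> u y" "u y < 1" "0 \<le> v x" "v x < 1" using u[OF xy(2)] v[OF xy(1)] by auto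
    obtain H where H: "\<And>h. H \<le> h \<Longrightarrow> j x y h = 0 \<and> j' x y h = 0" using fin[OF xy] by blast
    note fs = forward_strip[where j = "j x y" and j' = "j' x y" and \<nu> = "Lam x y",
        OF par uv Q[OF xy] zero zero zero strips H fp[OF xy]]
    show ?thesis
      by (intro conjI; rule fs)
  qed
  have strips: "(1 \<le> x \<longrightarrow> strip q s (v x) (Lam (x - 1) y) (Lam x y)) \<and>
    (1 \<le> y \<longrightarrow> strip q s (u y) (Lam x (y - 1)) (Lam x y))" for x y
  proof (induction "x + y" arbitrary: x y rule: less_induct)
    case less
    consider "x = 0" | "y = 0" | "1 \<le> x" "1 \<le> y" by linarith
    then show ?case
    proof cases
      case 1
      then show ?thesis using strip_empty[OF par] u[of y] empty by simp
    next
      case 2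
      then show ?thesis using strip_empty[OF par] v[of x] empty by simp
    next
      case 3
      have "strip q s (v x) (Lam (x - 1) (y - 1)) (Lam x (y - 1))"
        using less[of x "y - 1"] 3 by simp
      moreover have "strip q s (u y) (Lam (x - 1) (y - 1)) (Lam (x - 1) y)"
        using less[of "x - 1" y] 3 by simp
      ultimately show ?thesis using step[OF 3] by blast
    qed
  qed
  assume xy: "1 \<le> x" "1 \<le> y"
  have "strip q s (v x) (Lam (x - 1) (y - 1)) (Lam x (y - 1))"
    using strips[of x "y - 1"] xy by blast
  moreover have "strip q s (u y) (Lam (x - 1) (y - 1)) (Lam (x - 1) y)"
    using strips[of "x - 1" y] xy by blast
  ultimately show ?thesis using step[OF xy] by blast
qed

section \<open>Almost sure support of the field\<close>

lemma measurable_guard: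
  assumes "P \<Longrightarrow> f \<in> measurable M (count_space UNIV)"
  shows "(\<lambda>\<omega>. if P then f \<omega> else c) \<in> measurable M (count_space UNIV)"
  using assms by (cases P) simp_all

lemma YB_field_sampling:
  assumes "YB_field q Q u v M \<Lambda> J J'"
  shows "\<forall>d H. \<forall>\<sigma> :: nat \<Rightarrow> nat \<Rightarrow> diagram. \<forall>n j j' :: nat \<Rightarrow> nat \<Rightarrow> nat \<Rightarrow> nat.
        measure M {\<omega> \<in> space M.
            (\<forall>x y. x + y \<le> d \<longrightarrow> \<Lambda> x y \<omega> = \<sigma> x y) \<and>
            (\<forall>x\<ge>1. \<forall>y\<ge>1. x + y = d + 1 \<longrightarrow>
               (\<forall>h\<le>H. J x y h \<omega> = j x y h \<and> J' x y h \<omega> = j' x y h) \<and>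
               (\<forall>h\<in>{1..H}. count (\<Lambda> x y \<omega>) h = n x y h))} =
        measure M {\<omega> \<in> space M. \<forall>x y. x + y \<le> d \<longrightarrow> \<Lambda> x y \<omega> = \<sigma> x y} *
        (\<Prod>(x, y) \<in> layer d. forward_prob q Q (u y) (v x)
             (\<sigma> (x - 1) (y - 1)) (\<sigma> x (y - 1)) (\<sigma> (x - 1) y) H (n x y) (j x y) (j' x y))"
  using assms unfolding YB_field_def layer_def by (elim conjE)

text \<open>The sampling rule is applied to an outcome's own values, whose probability is almost
  surely positive. \<open>H\<close> is arbitrary because a transition is an infinite sequence of
  choices, tested through its initial segments.\<close>

lemma YB_field_AE_forward:
  assumes "YB_field q Q u v M \<Lambda> J J'"
  shows "AE \<omega> in M. \<forall>x\<ge>1. \<forall>y\<ge>1. \<forall>H. forward_prob q Q (u y) (v x)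
    (\<Lambda> (x - 1) (y - 1) \<omega>) (\<Lambda> x (y - 1) \<omega>) (\<Lambda> (x - 1) y \<omega>) H
    (count (\<Lambda> x y \<omega>)) (\<lambda>h. J x y h \<omega>) (\<lambda>h. J' x y h \<omega>) \<noteq> 0"
proof -
  have M: "prob_space M"
    and mL: "\<And>x y. \<Lambda> x y \<in> measurable M (count_space UNIV)"
    and mJ: "\<And>x y h. 1 \<le> x \<Longrightarrow> 1 \<le> y \<Longrightarrow> J x y h \<in> measurable M (count_space UNIV)"
      "\<And>x y h. 1 \<le> x \<Longrightarrow> 1 \<le> y \<Longrightarrow> J' x y h \<in> measurable M (count_space UNIV)"
    using assms unfolding YB_field_def by blast+
  note rule = YB_field_sampling[OF assms, rule_format]
  interpret prob_space M by (rule M)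
  define Z where "Z = (\<lambda>(x, y, h) \<omega>. (\<Lambda> x y \<omega>,
    if 1 \<le> x \<and> 1 \<le> y then J x y h \<omega> else 0, if 1 \<le> x \<and> 1 \<le> y then J' x y h \<omega> else 0))"
  have mZ: "Z i \<in> measurable M (count_space UNIV)" for i
  proof -
    obtain x y h where i: "i = (x, y, h)" by (cases i)
    show ?thesis
      unfolding i Z_def prod.case by (intro measurable_count_space_Pair measurable_guard mL mJ; elim conjE)
  qed
  let ?fp = "\<lambda>\<omega> H x y. forward_prob q Q (u y) (v x)
    (\<Lambda> (x - 1) (y - 1) \<omega>) (\<Lambda> x (y - 1) \<omega>) (\<Lambda> (x - 1) y \<omega>) H
    (count (\<Lambda> x y \<omega>)) (\<lambda>h. J x y h \<omega>) (\<lambda>h. J' x y h \<omega>)"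
  have "AE \<omega> in M. \<forall>(x, y)\<in>layer d. ?fp \<omega> H x y \<noteq> 0" for d H
  proof -
    let ?T = "{..d + 1} \<times> {..d + 1} \<times> {..H}"
    have T: "finite ?T" by simp
    show ?thesis
      using AE_fiber_pos[OF M T mZ]
    proof (rule AE_mp, intro AE_I2 impI)
      fix \<omega> assume \<omega>: "\<omega> \<in> space M" and pos: "0 < measure M {\<omega>' \<in> space M. \<forall>i\<in>?T. Z i \<omega>' = Z i \<omega>}"
      let ?L = "{\<omega>' \<in> space M. \<forall>i\<in>corner d. \<Lambda> (fst i) (snd i) \<omega>' = \<Lambda> (fst i) (snd i) \<omega>}"
      let ?J = "{\<omega>' \<in> space M. \<forall>i\<in>layer d \<times> {..H}. J (fst (fst i)) (snd (fst i)) (snd i) \<omega>' = J (fst (fst i)) (snd (fst i)) (snd i) \<omega>}"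
      let ?J' = "{\<omega>' \<in> space M. \<forall>i\<in>layer d \<times> {..H}. J' (fst (fst i)) (snd (fst i)) (snd i) \<omega>' = J' (fst (fst i)) (snd (fst i)) (snd i) \<omega>}"
      let ?N = "{\<omega>' \<in> space M. \<forall>i\<in>layer d \<times> {1..H}. count (\<Lambda> (fst (fst i)) (snd (fst i)) \<omega>') (snd i) = count (\<Lambda> (fst (fst i)) (snd (fst i)) \<omega>) (snd i)}"
      let ?E = "{\<omega>' \<in> space M.
            (\<forall>x y. x + y \<le> d \<longrightarrow> \<Lambda> x y \<omega>' = \<Lambda> x y \<omega>) \<and>
            (\<forall>x\<ge>1. \<forall>y\<ge>1. x + y = d + 1 \<longrightarrow>
               (\<forall>h\<le>H. J x y h \<omega>' = J x y h \<omega> \<and> J' x y h \<omega>' = J' x y h \<omega>) \<and>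
               (\<forall>h\<in>{1..H}. count (\<Lambda> x y \<omega>') h = count (\<Lambda> x y \<omega>) h))}"
      have mN: "(\<lambda>\<omega>. count (\<Lambda> x y \<omega>) h) \<in> measurable M (count_space UNIV)" for x y h
        by (rule measurable_compose[OF mL, of "\<lambda>m. count m h"]) simp
      have "?E = ?L \<inter> (?J \<inter> ?J' \<inter> ?N)"
        unfolding corner_def layer_def by auto
      also have "\<dots> \<in> sets M"
        using finite_layer[of d] finite_corner[of d]
        by (intro sets.Int sets_fiber mL mN mJ) (auto simp: layer_def)
      finally have E: "?E \<in> sets M" .
      \<comment> \<open>The fibre fixes the whole diagrams of the new layer, the event of the rule
        only their first \<open>H\<close> multiplicities; positivity passes to the larger event
        \<open>?E\<close>.\<close>
      have "{\<omega>' \<in> space M. \<forall>i\<in>?T. Z i \<omega>' = Z i \<omega>} \<subseteq> ?E"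
      proof (intro subsetI CollectI conjI allI impI ballI)
        fix \<omega>' assume "\<omega>' \<in> {\<omega>' \<in> space M. \<forall>i\<in>?T. Z i \<omega>' = Z i \<omega>}"
        then have Z: "\<omega>' \<in> space M" "\<And>x y h. x \<le> d + 1 \<Longrightarrow> y \<le> d + 1 \<Longrightarrow> h \<le> H \<Longrightarrow> Z (x, y, h) \<omega>' = Z (x, y, h) \<omega>"
          by auto
        show "\<omega>' \<in> space M" by (rule Z(1))
        show "\<Lambda> x y \<omega>' = \<Lambda> x y \<omega>" if "x + y \<le> d" for x y
          using Z(2)[of x y 0] that by (simp add: Z_def)
        fix x y assume xy: "1 \<le> x" "1 \<le> y" "x + y = d + 1"
        show "J x y h \<omega>' = J x y h \<omega>" "J' x y h \<omega>' = J' x y h \<omega>" if "h \<le> H" for h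
          using Z(2)[of x y h] that xy by (simp_all add: Z_def)
        show "count (\<Lambda> x y \<omega>') h = count (\<Lambda> x y \<omega>) h" for h
          using Z(2)[of x y 0] xy by (simp add: Z_def)
      qed
      with pos E have "0 < measure M ?E"
        using finite_measure_mono by (meson order_less_le_trans)
      moreover have "measure M ?E = measure M {\<omega>' \<in> space M. \<forall>x y. x + y \<le> d \<longrightarrow> \<Lambda> x y \<omega>' = \<Lambda> x y \<omega>} *
          (\<Prod>(x, y) \<in> layer d. ?fp \<omega> H x y)"
        by (rule rule[of d "\<lambda>x y. \<Lambda> x y \<omega>" H "\<lambda>x y h. J x y h \<omega>" "\<lambda>x y h. J' x y h \<omega>" "\<lambda>x y. count (\<Lambda> x y \<omega>)"])
      ultimately have "(\<Prod>(x, y) \<in> layer d. ?fp \<omega> H x y) \<noteq> 0"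
        by (auto simp only: mult_zero_right)
      then show "\<forall>(x, y)\<in>layer d. ?fp \<omega> H x y \<noteq> 0"
        using finite_layer[of d] by (simp add: prod_zero_iff split_beta)
    qed
  qed
  then have "AE \<omega> in M. \<forall>d H. \<forall>(x, y)\<in>layer d. ?fp \<omega> H x y \<noteq> 0"
    by (simp only: AE_all_countable) blast
  then show ?thesis
  proof (rule AE_mp, intro AE_I2 impI allI)
    fix \<omega> and x y H :: nat
    assume *: "\<forall>d H. \<forall>(x, y)\<in>layer d. ?fp \<omega> H x y \<noteq> 0" and "1 \<le> x" "1 \<le> y"
    then have "(x, y) \<in> layer (x + y - 1)" unfolding layer_def by auto
    with * show "?fp \<omega> H x y \<noteq> 0" by blast
  qed
qed

lemma YB_field_height_law:
  assumes par: "0 < q" "q < 1" "- 1 < s" "s < 0"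
    and u: "\<And>y. 1 \<le> y \<Longrightarrow> 0 \<le> u y \<and> u y < 1"
    and v: "\<And>x. 1 \<le> x \<Longrightarrow> 0 \<le> v x \<and> v x < 1"
    and Q: "\<And>x y. 1 \<le> x \<Longrightarrow> 1 \<le> y \<Longrightarrow> bijectivization q s (u y) (v x) Q"
    and YB: "YB_field q Q u v M \<Lambda> J J'"
  shows "height_law q u v M (\<lambda>x y \<omega>. int y - int (size (\<Lambda> x y \<omega>)))"
proof -
  have M: "prob_space M"
    and mL: "\<And>x y. \<Lambda> x y \<in> measurable M (count_space UNIV)"
    and mJ: "\<And>x y h. 1 \<le> x \<Longrightarrow> 1 \<le> y \<Longrightarrow> J x y h \<in> measurable M (count_space UNIV)"
      "\<And>x y h. 1 \<le> x \<Longrightarrow> 1 \<le> y \<Longrightarrow> J' x y h \<in> measurable M (count_space UNIV)"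
    and zero: "\<And>\<omega> x y. \<omega> \<in> space M \<Longrightarrow> 0 \<notin># \<Lambda> x y \<omega>"
    and empty: "\<And>\<omega> x. \<omega> \<in> space M \<Longrightarrow> \<Lambda> x 0 \<omega> = {#}" "\<And>\<omega> y. \<omega> \<in> space M \<Longrightarrow> \<Lambda> 0 y \<omega> = {#}"
    and fin: "\<And>x y. 1 \<le> x \<Longrightarrow> 1 \<le> y \<Longrightarrow> AE \<omega> in M. \<exists>H. \<forall>h\<ge>H. J x y h \<omega> = 0 \<and> J' x y h \<omega> = 0"
    using YB unfolding YB_field_def by blast+
  note rule = YB_field_sampling[OF YB, rule_format]
  interpret prob_space M by (rule M)
  define F where "F x y \<omega> = int y - int (size (\<Lambda> x y \<omega>))" for x y \<omega>
  have mF: "F x y \<in> measurable M (count_space UNIV)" for x y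
  proof -
    have "(\<lambda>\<omega>. int y - int (size (\<Lambda> x y \<omega>))) \<in> measurable M (count_space UNIV)"
      by (rule measurable_compose[OF mL, of "\<lambda>m. int y - int (size m)"]) simp
    then show ?thesis unfolding F_def[abs_def] .
  qed
  have F0: "F x 0 \<omega> = 0" "F 0 y \<omega> = int y" if "\<omega> \<in> space M" for \<omega> x y
    using empty[OF that] by (simp_all add: F_def)
  define good where "good \<omega> \<longleftrightarrow> (\<forall>x y. 1 \<le> x \<longrightarrow> 1 \<le> y \<longrightarrow>
    F x y \<omega> = F x (y - 1) \<omega> + 1 - int (J x y 0 \<omega>) \<and>
    F (x - 1) y \<omega> = F x y \<omega> + int (J' x y 0 \<omega>) \<and> J x y 0 \<omega> \<le> 1 \<and> J' x y 0 \<omega> \<le> 1)" for \<omega>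
  have goodD: "F x y \<omega> = F x (y - 1) \<omega> + 1 - int (J x y 0 \<omega>)" "F (x - 1) y \<omega> = F x y \<omega> + int (J' x y 0 \<omega>)"
      "J x y 0 \<omega> \<le> 1" "J' x y 0 \<omega> \<le> 1" if "good \<omega>" "1 \<le> x" "1 \<le> y" for \<omega> x y
    using that(1)[unfolded good_def, THEN spec, THEN spec, THEN mp, THEN mp, OF that(2,3)] by blast+
  have AE_good: "AE \<omega> in M. good \<omega>"
  proof -
    have "AE \<omega> in M. 1 \<le> x \<longrightarrow> 1 \<le> y \<longrightarrow> (\<exists>H. \<forall>h\<ge>H. J x y h \<omega> = 0 \<and> J' x y h \<omega> = 0)" for x y
      using fin[of x y] by (cases "1 \<le> x"; cases "1 \<le> y") simp_all
    then have "AE \<omega> in M. \<forall>x y. 1 \<le> x \<longrightarrow> 1 \<le> y \<longrightarrow> (\<exists>H. \<forall>h\<ge>H. J x y h \<omega> = 0 \<and> J' x y h \<omega> = 0)"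
      by (simp only: AE_all_countable) blast
    with YB_field_AE_forward[OF YB] AE_space show ?thesis
    proof eventually_elim
      fix \<omega>
      assume fp: "\<forall>x\<ge>1. \<forall>y\<ge>1. \<forall>H. forward_prob q Q (u y) (v x)
          (\<Lambda> (x - 1) (y - 1) \<omega>) (\<Lambda> x (y - 1) \<omega>) (\<Lambda> (x - 1) y \<omega>) H
          (count (\<Lambda> x y \<omega>)) (\<lambda>h. J x y h \<omega>) (\<lambda>h. J' x y h \<omega>) \<noteq> 0"
        and \<omega>: "\<omega> \<in> space M"
        and fn: "\<forall>x y. 1 \<le> x \<longrightarrow> 1 \<le> y \<longrightarrow> (\<exists>H. \<forall>h\<ge>H. J x y h \<omega> = 0 \<and> J' x y h \<omega> = 0)"
      have sz: "size (\<Lambda> x y \<omega>) = size (\<Lambda> x (y - 1) \<omega>) + J x y 0 \<omega> \<and>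
          size (\<Lambda> x y \<omega>) = size (\<Lambda> (x - 1) y \<omega>) + J' x y 0 \<omega> \<and> J x y 0 \<omega> \<le> 1 \<and> J' x y 0 \<omega> \<le> 1"
        if "1 \<le> x" "1 \<le> y" for x y
        by (rule field_strips[where q = q and s = s and u = u and v = v and Q = Q and
              Lam = "\<lambda>x y. \<Lambda> x y \<omega>" and j = "\<lambda>x y h. J x y h \<omega>" and j' = "\<lambda>x y h. J' x y h \<omega>",
              OF par u v Q zero[OF \<omega>] empty[OF \<omega>] fn[rule_format] fp[rule_format] that])
      show "good \<omega>"
        unfolding good_def F_def
      proof (intro allI impI)
        fix x y :: nat assume xy: "1 \<le> x" "1 \<le> y"
        have y: "int (y - 1) = int y - 1" using xy(2) by (simp add: of_nat_diff)
        show "int y - int (size (\<Lambda> x y \<omega>)) =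
            int (y - 1) - int (size (\<Lambda> x (y - 1) \<omega>)) + 1 - int (J x y 0 \<omega>) \<and>
          int y - int (size (\<Lambda> (x - 1) y \<omega>)) = int y - int (size (\<Lambda> x y \<omega>)) + int (J' x y 0 \<omega>) \<and>
          J x y 0 \<omega> \<le> 1 \<and> J' x y 0 \<omega> \<le> 1"
          using sz[OF xy] unfolding y by linarith
      qed
    qed
  qed
  have good_admissible: "admissible d (\<lambda>x y. F x y \<omega>)" if \<omega>: "good \<omega>" "\<omega> \<in> space M" for \<omega> d
    unfolding admissible_def
  proof (intro conjI allI impI)
    fix x y :: nat assume xy: "1 \<le> x" "1 \<le> y"
    note g = goodD[OF \<omega>(1) xy]
    show "F (x - 1) y \<omega> - F x y \<omega> \<in> {0, 1}" using g(2,4) by auto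
    show "F x y \<omega> - F x (y - 1) \<omega> \<in> {0, 1}" using g(1,3) by auto
  qed (use F0[OF \<omega>(2)] in auto)
  define A where "A d c = {\<omega> \<in> space M. \<forall>x y. x + y \<le> d \<longrightarrow> F x y \<omega> = c x y}" for d c
  \<comment> \<open>Given the heights on \<open>corner d\<close>, this is the event that j_0 and
    j'_0 continue them to \<open>c\<close> on the next layer.\<close>
  define B where "B d c = {\<omega> \<in> space M. \<forall>i\<in>layer d.
    J (fst i) (snd i) 0 \<omega> = 1 - horiz c (fst i) (snd i)} \<inter> {\<omega> \<in> space M. \<forall>i\<in>layer d.
    J' (fst i) (snd i) 0 \<omega> = vert c (fst i) (snd i)}" for d c
  have A_sets[measurable]: "A d c \<in> sets M" for d c
    using sets_fiber[of "corner d" "\<lambda>i. F (fst i) (snd i)" M "\<lambda>i. c (fst i) (snd i)"] mF finite_corner[of d]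
    unfolding A_def by (simp add: ball_corner)
  have B_sets[measurable]: "B d c \<in> sets M" for d c
    unfolding B_def using finite_layer[of d]
    by (intro sets.Int sets_fiber mJ) (auto simp: layer_def)
  have A_null: "measure M (A d c) = 0" if "\<not> admissible d c" for d c
  proof -
    have "measure M (A d c) = measure M {}"
    proof (rule measure_eq_AE)
      show "AE \<omega> in M. \<omega> \<in> A d c \<longleftrightarrow> \<omega> \<in> {}"
        using AE_good
      proof (rule AE_mp, intro AE_I2 impI)
        fix \<omega> assume "\<omega> \<in> space M" "good \<omega>"
        then have "admissible d (\<lambda>x y. F x y \<omega>)" by (rule good_admissible[rotated])
        then have "\<omega> \<notin> A d c" using that admissible_cong[of d "\<lambda>x y. F x y \<omega>" c] unfolding A_def by blast
        then show "\<omega> \<in> A d c \<longleftrightarrow> \<omega> \<in> {}" by simp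
      qed
    qed auto
    then show ?thesis by simp
  qed
  \<comment> \<open>Only an almost sure identity: the new diagrams and the auxiliary variables are
    separate random variables, and their relation is available on \<open>good\<close>.\<close>
  have A_Suc: "measure M (A (d + 1) c) = measure M (A d c \<inter> B d c)" if adm: "admissible (d + 1) c" for d c
  proof (rule measure_eq_AE)
    show "AE \<omega> in M. \<omega> \<in> A (d + 1) c \<longleftrightarrow> \<omega> \<in> A d c \<inter> B d c"
      using AE_good
    proof (rule AE_mp, intro AE_I2 impI iffI)
      fix \<omega> assume \<omega>: "\<omega> \<in> space M" "good \<omega>" "\<omega> \<in> A (d + 1) c"
      have F: "F x y \<omega> = c x y" if "x + y \<le> d + 1" for x y
        using \<omega>(3) that unfolding A_def by blast
      have "J x y 0 \<omega> = 1 - horiz c x y" "J' x y 0 \<omega> = vert c x y" if "(x, y) \<in> layer d" for x y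
      proof -
        from that have xy: "1 \<le> x" "1 \<le> y" "x + y = d + 1" by (auto simp: layer_def)
        have c: "F x y \<omega> = c x y" "F (x - 1) y \<omega> = c (x - 1) y" "F x (y - 1) \<omega> = c x (y - 1)"
          using xy by (auto intro!: F)
        show "J x y 0 \<omega> = 1 - horiz c x y" "J' x y 0 \<omega> = vert c x y"
          using goodD[OF \<omega>(2) xy(1,2)] unfolding c horiz_def vert_def by auto
      qed
      moreover have "\<omega> \<in> A d c" unfolding A_def using F \<omega>(1) by simp
      ultimately show "\<omega> \<in> A d c \<inter> B d c" using \<omega>(1) unfolding B_def by auto
    next
      fix \<omega> assume \<omega>: "\<omega> \<in> space M" "good \<omega>" "\<omega> \<in> A d c \<inter> B d c"
      have F: "F x y \<omega> = c x y" if "x + y \<le> d" for x y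
        using \<omega>(3) that unfolding A_def by blast
      have "F x y \<omega> = c x y" if xy: "x + y = d + 1" for x y
      proof -
        consider "x = 0" | "y = 0" | "1 \<le> x" "1 \<le> y" by linarith
        then show ?thesis
        proof cases
          case 1
          then show ?thesis using F0[OF \<omega>(1)] adm xy unfolding admissible_def by simp
        next
          case 2
          then show ?thesis using F0[OF \<omega>(1)] adm xy unfolding admissible_def by simp
        next
          case 3
          then have "(x, y) \<in> layer d" using xy by (simp add: layer_def)
          then have J: "J x y 0 \<omega> = 1 - horiz c x y" using \<omega>(3) unfolding B_def by auto
          have "F x (y - 1) \<omega> = c x (y - 1)" using xy 3 by (intro F) simp
          then show ?thesis
            using goodD(1)[OF \<omega>(2) 3] J admissible_horiz[OF adm 3(2), of x] xy by simp
        qed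
      qed
      with F have "F x y \<omega> = c x y" if "x + y \<le> d + 1" for x y
        using that by (cases "x + y = d + 1") simp_all
      then show "\<omega> \<in> A (d + 1) c" using \<omega>(1) unfolding A_def by simp
    qed
  qed (use sets.Int[OF A_sets B_sets] A_sets in auto)
  let ?L = "\<lambda>c x y. L6V q (u y * v x) (vert c x (y - 1)) (horiz c (x - 1) y) (vert c x y) (horiz c x y)"
  have A_B: "measure M (A d c \<inter> B d c) = measure M (A d c) * (\<Prod>(x, y)\<in>layer d. ?L c x y)"
    if adm: "admissible (d + 1) c" for d c
  proof -
    \<comment> \<open>Lumping over all families of diagrams on \<open>corner d\<close> whose lengths
      realize the heights \<open>c\<close>.\<close>
    let ?P = "\<lambda>z :: nat \<times> nat \<Rightarrow> diagram. \<forall>i\<in>corner d. int (snd i) - int (size (z i)) = c (fst i) (snd i)"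
    let ?Z = "\<lambda>i. \<Lambda> (fst i) (snd i)"
    let ?K = "\<Prod>(x, y)\<in>layer d. ?L c x y"
    have K: "0 \<le> ?K"
    proof (rule prod_nonneg, clarify)
      fix x y assume "(x, y) \<in> layer d"
      then have "0 \<le> u y * v x" "u y * v x < 1"
        using u[of y] v[of x] mult_less_one[of "u y" "v x"] by (auto simp: layer_def)
      then show "0 \<le> ?L c x y" using par by (intro L6V_nonneg)
    qed
    have meas: "measure M {\<omega> \<in> B d c. ?P (\<lambda>i\<in>corner d. ?Z i \<omega>)} = measure M {\<omega> \<in> space M. ?P (\<lambda>i\<in>corner d. ?Z i \<omega>)} * ?K"
    proof (rule measure_mult_fibers[where P = ?P and Z = ?Z and T = "corner d", OF M finite_corner mL B_sets K])
      fix z assume P: "?P z"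
      let ?E = "{\<omega> \<in> space M. \<forall>i\<in>corner d. ?Z i \<omega> = z i}"
      show "measure M (?E \<inter> B d c) = measure M ?E * ?K"
      \<comment> \<open>A value \<open>z\<close> attained by no outcome may contain parts equal to
        0, where \<open>excess_0\<close> does not apply; both sides are then 0. An attained value
        inherits positive parts from an outcome.\<close>
      proof (cases "?E = {}")
        case False
        then obtain \<omega> where \<omega>: "\<omega> \<in> space M" "\<And>i. i \<in> corner d \<Longrightarrow> ?Z i \<omega> = z i" by blast
        have z0: "0 \<notin># z i" if "i \<in> corner d" for i
          using zero[OF \<omega>(1), of "fst i" "snd i"] unfolding \<omega>(2)[OF that] .
        \<comment> \<open>The rule with \<open>H = 0\<close>: the auxiliary variables are inspected
          at index 0 alone, so constant sequences serve, and no multiplicity is prescribed.\<close>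
        have EB: "?E \<inter> B d c = {\<omega> \<in> space M.
            (\<forall>x y. x + y \<le> d \<longrightarrow> \<Lambda> x y \<omega> = z (x, y)) \<and>
            (\<forall>x\<ge>1. \<forall>y\<ge>1. x + y = d + 1 \<longrightarrow>
               (\<forall>h\<le>0. J x y h \<omega> = 1 - horiz c x y \<and> J' x y h \<omega> = vert c x y) \<and>
               (\<forall>h\<in>{1..0}. count (\<Lambda> x y \<omega>) h = 0))}"
          unfolding B_def ball_corner layer_def by auto
        have "measure M (?E \<inter> B d c) = measure M {\<omega> \<in> space M. \<forall>x y. x + y \<le> d \<longrightarrow> \<Lambda> x y \<omega> = z (x, y)} *
          (\<Prod>(x, y) \<in> layer d. forward_prob q Q (u y) (v x)
             (z (x - 1, y - 1)) (z (x, y - 1)) (z (x - 1, y)) 0 (\<lambda>h. 0) (\<lambda>h. 1 - horiz c x y) (\<lambda>h. vert c x y))"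
          unfolding EB by (rule rule[of d "\<lambda>x y. z (x, y)" 0 "\<lambda>x y h. 1 - horiz c x y" "\<lambda>x y h. vert c x y" "\<lambda>x y h. 0"])
        moreover have "{\<omega> \<in> space M. \<forall>x y. x + y \<le> d \<longrightarrow> \<Lambda> x y \<omega> = z (x, y)} = ?E"
          unfolding ball_corner by simp
        moreover have "(\<Prod>(x, y) \<in> layer d. forward_prob q Q (u y) (v x)
             (z (x - 1, y - 1)) (z (x, y - 1)) (z (x - 1, y)) 0 (\<lambda>h. 0) (\<lambda>h. 1 - horiz c x y) (\<lambda>h. vert c x y)) = ?K"
        proof (rule prod.cong[OF refl], clarify)
          fix x y assume "(x, y) \<in> layer d"
          then have xy: "1 \<le> x" "1 \<le> y" "x + y = d + 1" by (auto simp: layer_def)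
          have cor: "(x - 1, y - 1) \<in> corner d" "(x, y - 1) \<in> corner d" "(x - 1, y) \<in> corner d"
            using xy by (auto simp: corner_def)
          have sz: "int (y - 1) - int (size (z (x - 1, y - 1))) = c (x - 1) (y - 1)"
            "int (y - 1) - int (size (z (x, y - 1))) = c x (y - 1)"
            "int y - int (size (z (x - 1, y))) = c (x - 1) y"
            using bspec[OF P cor(1)] bspec[OF P cor(2)] bspec[OF P cor(3)] by (simp_all only: fst_conv snd_conv)
          have "excess (z (x - 1, y - 1)) (z (x, y - 1)) 0 = vert c x (y - 1)"
            unfolding excess_0[OF z0 z0, OF cor(1,2)] vert_def sz(1,2)[symmetric] by simp
          \<comment> \<open>i'_0 is the increment of length in the y direction, that is, 1 minus the
            increment of height.\<close>
          moreover have "excess (z (x - 1, y - 1)) (z (x - 1, y)) 0 = 1 - horiz c (x - 1) y"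
          proof -
            have "int (size (z (x - 1, y))) - int (size (z (x - 1, y - 1))) = 1 - int (horiz c (x - 1) y)"
              using sz(1,3) admissible_horiz(1)[OF adm xy(2), of "x - 1"] xy
              by (simp add: of_nat_diff)
            then show ?thesis
              unfolding excess_0[OF z0 z0, OF cor(1,3)] by simp
          qed
          moreover have "init_prob q (u y) (v x) (vert c x (y - 1)) (1 - horiz c (x - 1) y)
              (1 - horiz c x y) (vert c x y) = ?L c x y"
            using u[OF xy(2)] v[OF xy(1)] xy par
            by (intro init_prob_L6V admissible_horiz(2)[OF adm] admissible_vert(2)[OF adm]) auto
          ultimately show "forward_prob q Q (u y) (v x)
             (z (x - 1, y - 1)) (z (x, y - 1)) (z (x - 1, y)) 0 (\<lambda>h. 0) (\<lambda>h. 1 - horiz c x y) (\<lambda>h. vert c x y)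
             = ?L c x y"
            unfolding forward_prob_def Let_def by simp
        qed
        ultimately show ?thesis by (simp only:)
      next
        case True
        show ?thesis unfolding True by simp
      qed
    qed
    have PF: "?P (\<lambda>i\<in>corner d. ?Z i \<omega>) \<longleftrightarrow> (\<forall>x y. x + y \<le> d \<longrightarrow> F x y \<omega> = c x y)" for \<omega>
      unfolding ball_corner F_def by (simp add: corner_def)
    have "{\<omega> \<in> B d c. ?P (\<lambda>i\<in>corner d. ?Z i \<omega>)} = A d c \<inter> B d c"
      "{\<omega> \<in> space M. ?P (\<lambda>i\<in>corner d. ?Z i \<omega>)} = A d c"
      unfolding A_def PF B_def by blast+
    with meas show ?thesis by (simp only:)
  qed
  have "measure M (A (d + 1) c) = (if admissible (d + 1) c then measure M (A d c) *
      (\<Prod>(x, y)\<in>layer d. ?L c x y) else 0)" for d c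
    using A_null[of "d + 1" c] A_Suc[of d c] A_B[of d c] by (cases "admissible (d + 1) c") simp_all
  moreover have "F 0 0 \<omega> = 0" if "\<omega> \<in> space M" for \<omega> by (rule F0(1)[OF that])
  ultimately show ?thesis
    unfolding height_law_def F_def[symmetric] A_def[symmetric] using M mF by blast
qed

theorem theorem7p8:
  fixes q s :: real
    and u v :: "nat \<Rightarrow> real"
    and Q :: couplings
    and M :: "'a measure"
    and \<Lambda> :: "nat \<Rightarrow> nat \<Rightarrow> 'a \<Rightarrow> diagram"
    and J J' :: "nat \<Rightarrow> nat \<Rightarrow> nat \<Rightarrow> 'a \<Rightarrow> nat"
    and N :: "'b measure"
    and V W :: "nat \<Rightarrow> nat \<Rightarrow> 'b \<Rightarrow> nat"
  assumes "0 < q" "q < 1" "- 1 < s" "s < 0"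
    and "\<And>y. 1 \<le> y \<Longrightarrow> 0 \<le> u y \<and> u y < 1"
    and "\<And>x. 1 \<le> x \<Longrightarrow> 0 \<le> v x \<and> v x < 1"
    and "\<And>x y. 1 \<le> x \<Longrightarrow> 1 \<le> y \<Longrightarrow> bijectivization q s (u y) (v x) Q"
    and "YB_field q Q u v M \<Lambda> J J'"
    and "six_vertex q u v N V W"
  shows "distr M (PiM UNIV (\<lambda>_::nat \<times> nat. count_space (UNIV :: int set)))
            (\<lambda>\<omega> (x, y). int y - int (size (\<Lambda> x y \<omega>))) =
         distr N (PiM UNIV (\<lambda>_::nat \<times> nat. count_space (UNIV :: int set)))
            (\<lambda>\<omega> (x, y). int (height6V W (x + 1) y \<omega>))"
  by (rule height_law_unique[OF YB_field_height_law[OF assms(1-4) _ _ _ assms(8)]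
        six_vertex_height_law[OF assms(9)]]) (rule assms; assumption)+

end
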